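(* Let $0<\phi<1$, let $\{Z_s,s\in\mathbb{Z}^2\}$ be iid unit Fréchet random variables, and let $$X_t=\max_{s\in\mathbb{Z}^2}\phi^{\|s\|}Z_{t-s},\qquad t\in\mathbb{Z}^2 .$$ Let $m_n,r_n\to\infty$ satisfy $r_n^2=o(m_n)$, $\log m_n=o(r_n)$ and $\log n=o(m_n)$, and let $a_m=a_{m_n}$ with $P(|X_{\mathbf 0}|>a_m)\sim1/m_n$. Then for every fixed $\gamma$, with $B_\gamma=\{s\in\mathbb{Z}^2:\|s\|\le\gamma\}$ and $c=\#B_\gamma$, the following four conditions hold: $$\lim_{K\to\infty}\limsup_{n\to\infty}m_n\sum_{l\in\mathbb{Z}^2,\;K<\|l\|\le r_n}P\Big(\max_{s\in B_\gamma}|X_s|>\epsilon a_m,\ \max_{s'\in B_\gamma+l}|X_{s'}|>\epsilon a_m\Big)=0\quad\text{for all }\epsilon>0,$$ $$\lim_{n\to\infty}m_n\sum_{l\in\mathbb{Z}^2,\;r_n<\|l\|}\alpha_{c,c}(\|l\|)=0,$$ $$\sum_{l\in\mathbb{Z}^2}\alpha_{j_1,j_2}(\|l\|)<\infty\quad\text{for }2c\le j_1+j_2\le4c,$$ $$\lim_{n\to\infty}n\,m_n^{1/2}\,\alpha_{c,cn^2}(m_n)=0 .$$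
   Context: $\|\cdot\|$ is the Euclidean norm. Unit Fréchet means $P(Z\le x)=e^{-1/x}$, $x>0$. The mixing coefficients of the field are $$\alpha_{j,k}(r)=\sup\{\alpha(\sigma(X_s,s\in S),\sigma(X_s,s\in T)):S,T\subset\mathbb{Z}^2,\ \#S\le j,\ \#T\le k,\ d(S,T)\ge r\},$$ with $\alpha(\mathcal A,\mathcal B)=\sup\{|P(E\cap F)-P(E)P(F)|:E\in\mathcal A,F\in\mathcal B\}$ and $d(S,T)=\inf\{\|s-t\|:s\in S,t\in T\}$. *)

theory Defs
  imports "HOL-Probability.Probability" "HOL-Library.Landau_Symbols"
begin

text \<open>The lattice $Z^2$ is \<^typ>\<open>int \<times> int\<close>; the product norm on \<^typ>\<open>real \<times> real\<close> is Euclidean.\<close>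

definition lnorm :: "int \<times> int \<Rightarrow> real" where
  "lnorm s = norm (real_of_int (fst s), real_of_int (snd s))"

definition lball :: "real \<Rightarrow> (int \<times> int) set" where
  "lball \<gamma> = {s. lnorm s \<le> \<gamma>}"

text \<open>Extended-real valued, so that the distance to the empty set is $\infty$.\<close>

definition lattice_dist :: "(int \<times> int) set \<Rightarrow> (int \<times> int) set \<Rightarrow> ereal" where
  "lattice_dist S T = (INF (s, t) \<in> S \<times> T. ereal (lnorm (s - t)))"

definition gen_sigma ::
    "'a measure \<Rightarrow> (int \<times> int \<Rightarrow> 'a \<Rightarrow> real) \<Rightarrow> (int \<times> int) set \<Rightarrow> 'a set set" where
  "gen_sigma M X S =
     sigma_sets (space M) (\<Union>s\<in>S. {X s -` A \<inter> space M |A. A \<in> sets borel})"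

definition alpha_mixing :: "'a measure \<Rightarrow> 'a set set \<Rightarrow> 'a set set \<Rightarrow> real" where
  "alpha_mixing M \<A> \<B> =
     (SUP (E, F) \<in> \<A> \<times> \<B>. \<bar>measure M (E \<inter> F) - measure M E * measure M F\<bar>)"

text \<open>Finiteness is explicit because \<^const>\<open>card\<close> is 0 on infinite sets. For a probability
  measure both suprema are over nonempty sets of reals bounded by 1; the pair of empty index sets
  is always admissible and contributes 0.\<close>

definition mixing_coeff ::
    "'a measure \<Rightarrow> (int \<times> int \<Rightarrow> 'a \<Rightarrow> real) \<Rightarrow> nat \<Rightarrow> nat \<Rightarrow> real \<Rightarrow> real" where
  "mixing_coeff M X j k r =
     (SUP (S, T) \<in> {(S, T). finite S \<and> card S \<le> j \<and> finite T \<and> card T \<le> k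
                          \<and> ereal r \<le> lattice_dist S T}.
        alpha_mixing M (gen_sigma M X S) (gen_sigma M X T))"

text \<open>The law is determined by its distribution function on $(0,\infty)$; the limit $x \to 0$ forces
  $P(Z \le 0) = 0$.\<close>

definition unit_frechet :: "'a measure \<Rightarrow> ('a \<Rightarrow> real) \<Rightarrow> bool" where
  "unit_frechet M Z \<longleftrightarrow> Z \<in> borel_measurable M \<and>
     (\<forall>x>0. measure M {\<omega> \<in> space M. Z \<omega> \<le> x} = exp (- 1 / x))"

text \<open>For iid unit Frechet \<open>Z\<close> and \<open>0 < \<phi> < 1\<close> the supremum is almost surely finite and attained.
  On the null set where it is infinite, the real supremum is a fixed number, which changes neither
  probabilities nor mixing coefficients.\<close>

definition max_moving :: "real \<Rightarrow> (int \<times> int \<Rightarrow> 'a \<Rightarrow> real) \<Rightarrow> int \<times> int \<Rightarrow> 'a \<Rightarrow> real" where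
  "max_moving \<phi> Z t \<omega> = (SUP s. \<phi> powr lnorm s * Z (t - s) \<omega>)"

definition exceed :: "(int \<times> int \<Rightarrow> 'a \<Rightarrow> real) \<Rightarrow> (int \<times> int) set \<Rightarrow> real \<Rightarrow> 'a \<Rightarrow> bool" where
  "exceed X B u \<omega> \<longleftrightarrow> Max ((\<lambda>s. \<bar>X s \<omega>\<bar>) ` B) > u"

end

theory Submission imports Defs begin

text \<open>Since \<open>P(Z > y) \<le> 1/y\<close>, everything reduces to union bounds over the summable weights
  \<open>\<phi>\<^bsup>|s|\<^esup>\<close>. Two sites at distance \<open>d\<close> both exceed \<open>x\<close> either through two different noise
  variables, with probability \<open>O(1/x\<^sup>2)\<close>, or through a common one, with probability
  \<open>O(\<phi>\<^bsup>d/4\<^esup>/x)\<close>; and \<open>a\<^sub>m\<close> is at least of order \<open>m\<close>, which gives the first condition.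
  For the mixing coefficients, replace \<open>X\<close> by the maximum over lags shorter than \<open>r/2\<close>. At distance
  \<open>r\<close> the truncated fields are independent, and truncation changes \<open>X\<^sub>s\<close> only if some far weighted
  noise variable beats \<open>Z\<^sub>s\<close>, which has probability exponentially small in \<open>r\<close>. Hence
  \<open>\<alpha>\<^sub>j\<^sub>k(r)\<close> is at most a constant times \<open>(j + k) \<phi>\<^bsup>r/8\<^esup>\<close>.\<close>

section \<open>Summation over the lattice\<close>

lemma lnorm_nonneg [simp]: "0 \<le> lnorm s"
  by (simp add: lnorm_def)

lemma lnorm_zero [simp]: "lnorm 0 = 0"
  by (simp add: lnorm_def zero_prod_def)

lemma lnorm_eq_0_iff [simp]: "lnorm s = 0 \<longleftrightarrow> s = 0"
  by (cases s) (simp add: lnorm_def zero_prod_def)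

lemma lnorm_triangle: "lnorm (s + t) \<le> lnorm s + lnorm t"
  using norm_triangle_ineq[of "(real_of_int (fst s), real_of_int (snd s))"
      "(real_of_int (fst t), real_of_int (snd t))"]
  by (simp add: lnorm_def)

lemma lnorm_uminus [simp]: "lnorm (- s) = lnorm s"
  by (simp add: lnorm_def norm_prod_def)

lemma lnorm_minus_commute: "lnorm (s - t) = lnorm (t - s)"
  using lnorm_uminus[of "s - t"] by simp

lemma lnorm_triangle_sub: "lnorm (s - t) \<le> lnorm (s - v) + lnorm (t - v)"
  using lnorm_triangle[of "s - v" "v - t"] lnorm_minus_commute[of v t] by simp

lemma abs_fst_le_lnorm: "\<bar>real_of_int (fst s)\<bar> \<le> lnorm s"
  using norm_fst_le[of "real_of_int (fst s)" "real_of_int (snd s)"] by (simp add: lnorm_def)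

lemma abs_snd_le_lnorm: "\<bar>real_of_int (snd s)\<bar> \<le> lnorm s"
  using norm_snd_le[of "real_of_int (snd s)" "real_of_int (fst s)"] by (simp add: lnorm_def)

lemma lball_subset: "lball R \<subseteq> {- \<lfloor>R\<rfloor>..\<lfloor>R\<rfloor>} \<times> {- \<lfloor>R\<rfloor>..\<lfloor>R\<rfloor>}"
proof
  fix s assume "s \<in> lball R"
  then have "lnorm s \<le> R" by (simp add: lball_def)
  then have "\<bar>real_of_int (fst s)\<bar> \<le> R" "\<bar>real_of_int (snd s)\<bar> \<le> R"
    using abs_fst_le_lnorm[of s] abs_snd_le_lnorm[of s] by linarith+
  then have "\<bar>fst s\<bar> \<le> \<lfloor>R\<rfloor>" "\<bar>snd s\<bar> \<le> \<lfloor>R\<rfloor>"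
    by (simp_all add: le_floor_iff)
  then show "s \<in> {- \<lfloor>R\<rfloor>..\<lfloor>R\<rfloor>} \<times> {- \<lfloor>R\<rfloor>..\<lfloor>R\<rfloor>}"
    by (cases s) auto
qed

lemma finite_lball [simp]: "finite (lball R)"
  by (rule finite_subset[OF lball_subset]) simp

lemma card_lball_le:
  assumes "1 \<le> R"
  shows "real (card (lball R)) \<le> 9 * R\<^sup>2"
proof -
  let ?N = "\<lfloor>R\<rfloor>"
  have N: "1 \<le> ?N" "real_of_int ?N \<le> R" using assms by (simp_all add: le_floor_iff)
  have "card (lball R) \<le> card ({- ?N..?N} \<times> {- ?N..?N})"
    by (intro card_mono lball_subset) simp
  also have "real \<dots> = (real_of_int (2 * ?N + 1))\<^sup>2"
    using N by (simp add: card_cartesian_product power2_eq_square)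
  finally have "real (card (lball R)) \<le> (real_of_int (2 * ?N + 1))\<^sup>2" by simp
  \<comment> \<open>For \<open>R \<ge> 1\<close> the side \<open>2 * ?N + 1\<close> of the enclosing
    square is at most \<open>3 * R\<close>, whence the constant 9.\<close>
  also have "\<dots> \<le> (3 * R)\<^sup>2"
  proof (intro power_mono)
    show "real_of_int (2 * ?N + 1) \<le> 3 * R" using N(2) assms by (simp del: of_int_floor_le)
    show "0 \<le> real_of_int (2 * ?N + 1)" using N(1) by simp
  qed
  finally show ?thesis by (simp add: power_mult_distrib)
qed

text \<open>Two geometric series, over the non-negative and the non-positive integers, cover the
  line; their overlap at 0 does not affect summability.\<close>

lemma summable_on_powr_abs_int:
  fixes p :: real
  assumes "0 < p" "p < 1"
  shows "(\<lambda>x::int. p powr \<bar>real_of_int x\<bar>) summable_on UNIV"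
proof -
  have "(\<lambda>n. p ^ n) summable_on (UNIV :: nat set)"
    using assms by (subst summable_on_UNIV_nonneg_real_iff) (auto intro: summable_geometric)
  then have nat: "(\<lambda>n. p powr real n) summable_on (UNIV :: nat set)"
    using assms by (simp add: powr_realpow)
  have "(\<lambda>x::int. p powr \<bar>real_of_int x\<bar>) summable_on range int"
    using nat by (subst summable_on_reindex) (auto simp: o_def)
  moreover have "(\<lambda>x::int. p powr \<bar>real_of_int x\<bar>) summable_on range (\<lambda>n. - int n)"
    using nat by (subst summable_on_reindex) (auto simp: o_def inj_def)
  ultimately have "(\<lambda>x::int. p powr \<bar>real_of_int x\<bar>) summable_on range int \<union> range (\<lambda>n. - int n)"
    by (rule summable_on_union)
  moreover have "range int \<union> range (\<lambda>n. - int n) = UNIV"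
    by (auto intro: int_cases2)
  ultimately show ?thesis by simp
qed

text \<open>The norm dominates both coordinates, hence their average. The weight is therefore at
  most a product of two one-dimensional geometric weights with ratio \<open>p\<close>, the square
  root of \<open>q\<close>.\<close>

lemma summable_on_powr_lnorm:
  fixes q :: real
  assumes "0 < q" "q < 1"
  shows "(\<lambda>l. q powr lnorm l) summable_on UNIV"
proof -
  define p where "p = q powr (1/2)"
  have p: "0 < p" "p < 1"
    using assms by (auto simp: p_def powr01_less_one)
  let ?f = "\<lambda>x::int. p powr \<bar>real_of_int x\<bar>"
  have f: "(?f has_sum infsum ?f UNIV) UNIV"
    using summable_on_powr_abs_int[OF p] by (rule has_sum_infsum)
  have "(\<lambda>(x, y). ?f x * ?f y) summable_on (UNIV \<times> UNIV)"
  proof (rule summable_on_SigmaI)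
    show "((\<lambda>y. case (x, y) of (x, y) \<Rightarrow> ?f x * ?f y) has_sum ?f x * infsum ?f UNIV) UNIV" for x
      using has_sum_cmult_right[OF f] by simp
    show "(\<lambda>x. ?f x * infsum ?f UNIV) summable_on UNIV"
      using summable_on_powr_abs_int[OF p] by (rule summable_on_cmult_left)
  qed auto
  then have "(\<lambda>l. ?f (fst l) * ?f (snd l)) summable_on UNIV"
    by (simp add: case_prod_unfold)
  then show ?thesis
  proof (rule summable_on_comparison_test)
    fix l :: "int \<times> int"
    have "q powr lnorm l \<le> q powr ((\<bar>real_of_int (fst l)\<bar> + \<bar>real_of_int (snd l)\<bar>) / 2)"
      using assms abs_fst_le_lnorm[of l] abs_snd_le_lnorm[of l] by (intro powr_mono') auto
    also have "\<dots> = ?f (fst l) * ?f (snd l)"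
      by (simp add: p_def powr_powr add_divide_distrib flip: powr_add)
    finally show "q powr lnorm l \<le> ?f (fst l) * ?f (snd l)" .
  qed auto
qed

text \<open>Every constant in the estimates below is built from values of this sum at \<phi> and its
  fractional powers.\<close>

definition geo_sum :: "real \<Rightarrow> real" where
  "geo_sum q = (\<Sum>\<^sub>\<infinity>l. q powr lnorm l)"

lemma geo_sum_nonneg: "0 \<le> geo_sum q"
  unfolding geo_sum_def by (intro infsum_nonneg) simp

lemma has_sum_powr_lnorm:
  assumes "0 < q" "q < 1"
  shows "((\<lambda>l. q powr lnorm l) has_sum geo_sum q) UNIV"
  unfolding geo_sum_def by (intro has_sum_infsum summable_on_powr_lnorm assms)

text \<open>The reflection through \<open>s\<close> is its own inverse, so the total weight seen
  from a site is the same for every site.\<close>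

lemma has_sum_powr_lnorm_shift:
  assumes "0 < q" "q < 1"
  shows "((\<lambda>l. q powr lnorm (s - l)) has_sum geo_sum q) UNIV"
proof -
  have "bij (\<lambda>l. s - l)" by (rule o_bij[of "\<lambda>l. s - l"]) auto
  from has_sum_reindex_bij_betw[OF this, of "\<lambda>l. q powr lnorm l" "geo_sum q"]
  show ?thesis using has_sum_powr_lnorm[OF assms] by simp
qed

text \<open>The countable union bound in terms of \<open>has_sum\<close>, so that lattice sites can
  serve as indices directly. Finite unions along the enumeration \<open>to_nat\<close> exhaust the
  whole union, and continuity from below passes to the limit.\<close>

lemma (in prob_space) prob_UN_le_has_sum:
  fixes A :: "'i::countable \<Rightarrow> 'a set"
  assumes A: "\<And>i. A i \<in> events" and le: "\<And>i. prob (A i) \<le> f i"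
    and sum: "(f has_sum b) UNIV"
  shows "prob (\<Union>i. A i) \<le> b"
proof -
  define B where "B n = (\<Union>i\<in>{i. to_nat i < n}. A i)" for n
  have fin: "finite {i::'i. to_nat i < n}" for n
  proof (rule finite_imageD[where f = to_nat])
    show "finite (to_nat ` {i::'i. to_nat i < n})" by (rule finite_subset[of _ "{..<n}"]) auto
    show "inj_on to_nat {i::'i. to_nat i < n}" by (rule inj_on_subset[OF inj_to_nat]) simp
  qed
  have nonneg: "0 \<le> f i" for i using le[of i] measure_nonneg[of M "A i"] by linarith
  have "prob (B n) \<le> b" for n
  proof -
    have "prob (B n) \<le> (\<Sum>i | to_nat i < n. prob (A i))"
      unfolding B_def using A fin by (intro finite_measure_subadditive_finite) auto
    also have "\<dots> \<le> (\<Sum>i | to_nat i < n. f i)" by (intro sum_mono le)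
    also have "\<dots> \<le> b" using nonneg fin by (intro finite_sum_le_has_sum[OF sum]) auto
    finally show ?thesis .
  qed
  moreover have "(\<lambda>n. prob (B n)) \<longlonglongrightarrow> prob (\<Union>n. B n)"
  proof (rule finite_Lim_measure_incseq)
    show "range B \<subseteq> events" unfolding B_def using A fin by (auto intro!: sets.finite_UN)
    show "incseq B" unfolding B_def by (intro monoI UN_mono) auto
  qed
  moreover have "(\<Union>n. B n) = (\<Union>i. A i)" unfolding B_def by blast
  ultimately show ?thesis by (intro LIMSEQ_le_const2[where X = "\<lambda>n. prob (B n)"]) auto
qed

text \<open>Bounds the lower tail of the unit Frechet law linearly; it is the inequality
  \<open>y \<le> exp y\<close> at \<open>y = 1 / x\<close>, inverted.\<close>

lemma exp_minus_inverse_le: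
  fixes x :: real
  assumes "0 < x"
  shows "exp (- 1 / x) \<le> x"
proof -
  have "1 / x \<le> exp (1 / x)" using exp_ge_add_one_self[of "1 / x"] by linarith
  then have "inverse (exp (1 / x)) \<le> inverse (1 / x)" using assms by (intro le_imp_inverse_le) auto
  then show ?thesis by (simp add: exp_minus)
qed

section \<open>Joint exceedances\<close>

lemma not_bdd_above_rangeD:
  fixes f :: "'b \<Rightarrow> 'c::linorder"
  assumes "\<not> bdd_above (range f)"
  shows "\<exists>u. x < f u"
  using assms by (auto simp: bdd_above_def not_le)

section \<open>Tails of the noise variables and shocks caused by them\<close>

locale frechet_field = prob_space M for M :: "'a measure" +
  fixes Z :: "int \<times> int \<Rightarrow> 'a \<Rightarrow> real" and \<phi> :: real
  assumes phi_pos: "0 < \<phi>" and phi_less_1: "\<phi> < 1"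
    and indep_Z: "indep_vars (\<lambda>_. borel) Z UNIV"
    and frechet_Z: "\<And>s. unit_frechet M (Z s)"
begin

lemma measurable_Z [measurable]: "Z s \<in> borel_measurable M"
  using frechet_Z[of s] by (simp add: unit_frechet_def)

lemma prob_Z_le: "0 < x \<Longrightarrow> prob {\<omega> \<in> space M. Z s \<omega> \<le> x} = exp (- 1 / x)"
  using frechet_Z[of s] by (simp add: unit_frechet_def)

lemma prob_Z_gt:
  assumes "0 < x"
  shows "prob {\<omega> \<in> space M. x < Z s \<omega>} = 1 - exp (- 1 / x)"
proof -
  have "{\<omega> \<in> space M. x < Z s \<omega>} = space M - {\<omega> \<in> space M. Z s \<omega> \<le> x}" by auto
  then show ?thesis using prob_compl[of "{\<omega> \<in> space M. Z s \<omega> \<le> x}"] prob_Z_le[OF assms] by simp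
qed

lemma prob_Z_gt_le:
  assumes "0 < x"
  shows "prob {\<omega> \<in> space M. x < Z s \<omega>} \<le> 1 / x"
  using exp_ge_add_one_self[of "- 1 / x"] prob_Z_gt[OF assms, of s] by simp

text \<open>The distribution function is prescribed on positive reals only, and its limit at 0 rules
  out non-positive values. Countability of the lattice gives one null set for all sites.\<close>

lemma AE_Z_pos: "AE \<omega> in M. \<forall>s. 0 < Z s \<omega>"
proof -
  have "AE \<omega> in M. 0 < Z s \<omega>" for s
  proof -
    \<comment> \<open>The summand 0 gives the bound the shape that \<open>field_le_epsilon\<close>
      expects.\<close>
    have "prob {\<omega> \<in> space M. Z s \<omega> \<le> 0} \<le> 0 + x" if "0 < x" for x
    proof -
      have "prob {\<omega> \<in> space M. Z s \<omega> \<le> 0} \<le> prob {\<omega> \<in> space M. Z s \<omega> \<le> x}"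
        using that by (intro finite_measure_mono) auto
      then show ?thesis using prob_Z_le[OF that, of s] exp_minus_inverse_le[OF that] by simp
    qed
    then have "prob {\<omega> \<in> space M. Z s \<omega> \<le> 0} \<le> 0"
      by (rule field_le_epsilon)
    then have "prob {\<omega> \<in> space M. Z s \<omega> \<le> 0} = 0"
      by (simp add: measure_le_0_iff)
    then have "AE \<omega> in M. \<omega> \<notin> {\<omega> \<in> space M. Z s \<omega> \<le> 0}"
      by (subst (asm) prob_eq_0) auto
    then show ?thesis by (rule AE_mp) (intro AE_I2, auto)
  qed
  then show ?thesis by (simp add: AE_all_countable)
qed

lemma prob_two_Z_gt_le:
  assumes "0 < x" "0 < y" "v \<noteq> w"
  shows "prob {\<omega> \<in> space M. x < Z v \<omega> \<and> y < Z w \<omega>} \<le> 1 / x * (1 / y)"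
proof -
  define A where "A i = (if i = v then {x<..} else {y<..})" for i
  have "prob (\<Inter>i\<in>{v, w}. Z i -` A i \<inter> space M) = (\<Prod>i\<in>{v, w}. prob (Z i -` A i \<inter> space M))"
    by (rule indep_varsD[OF indep_Z]) (auto simp: A_def)
  also have "(\<Inter>i\<in>{v, w}. Z i -` A i \<inter> space M) = {\<omega> \<in> space M. x < Z v \<omega> \<and> y < Z w \<omega>}"
    using assms by (auto simp: A_def)
  also have "(\<Prod>i\<in>{v, w}. prob (Z i -` A i \<inter> space M)) =
      prob {\<omega> \<in> space M. x < Z v \<omega>} * prob {\<omega> \<in> space M. y < Z w \<omega>}"
    using assms by (simp add: A_def) (intro arg_cong2[where f = "(*)"] arg_cong[where f = prob]; auto)
  also have "\<dots> \<le> 1 / x * (1 / y)"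
    using assms by (intro mult_mono prob_Z_gt_le) auto
  finally show ?thesis .
qed

text \<open>Indexed by the site \<open>v\<close> carrying the noise rather than by the lag \<open>s - v\<close>, so that clusters
  at two sites can be compared noise variable by noise variable.\<close>

definition shock :: "int \<times> int \<Rightarrow> real \<Rightarrow> 'a set" where
  "shock s x = (\<Union>v. {\<omega> \<in> space M. x / \<phi> powr lnorm (s - v) < Z v \<omega>})"

lemma shock_events [measurable]: "shock s x \<in> events"
  unfolding shock_def by measurable

lemma shockI:
  assumes "\<omega> \<in> space M" "x < \<phi> powr lnorm u * Z (s - u) \<omega>"
  shows "\<omega> \<in> shock s x"
proof -
  have "x / \<phi> powr lnorm (s - (s - u)) < Z (s - u) \<omega>"
    using assms phi_pos by (simp add: field_simps)
  then show ?thesis using assms(1) unfolding shock_def by blast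
qed

lemma prob_shock_le:
  assumes "0 < x"
  shows "prob (shock s x) \<le> 1 / x * geo_sum \<phi>"
  unfolding shock_def
proof (rule prob_UN_le_has_sum)
  show "((\<lambda>v. 1 / x * \<phi> powr lnorm (s - v)) has_sum 1 / x * geo_sum \<phi>) UNIV"
    by (intro has_sum_cmult_right has_sum_powr_lnorm_shift phi_pos phi_less_1)
  show "prob {\<omega> \<in> space M. x / \<phi> powr lnorm (s - v) < Z v \<omega>} \<le> 1 / x * \<phi> powr lnorm (s - v)" for v
    using prob_Z_gt_le[of "x / \<phi> powr lnorm (s - v)" v] assms phi_pos by simp
qed simp

text \<open>A noise variable passing both levels passes the higher one, set by the larger distance
  \<open>\<mu>\<close>. Since \<open>2 * \<mu>\<close> is at least the distance of \<open>s\<close>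
  and \<open>t\<close>, the exponent \<open>\<mu>\<close> pays for a quarter of that distance and
  for a quarter of the distance to \<open>v\<close>; the latter keeps the bound summable over
  \<open>v\<close>.\<close>

lemma prob_single_shock_le:
  assumes "0 < x"
  shows "prob {\<omega> \<in> space M. x / \<phi> powr lnorm (s - v) < Z v \<omega> \<and> x / \<phi> powr lnorm (t - v) < Z v \<omega>}
    \<le> \<phi> powr (lnorm (s - t) / 4) / x * (\<phi> powr (1/4)) powr lnorm (s - v)"
proof -
  define \<mu> where "\<mu> = max (lnorm (s - v)) (lnorm (t - v))"
  have "lnorm (s - t) / 4 + lnorm (s - v) / 4 \<le> \<mu>"
    using lnorm_triangle_sub[of s t v] lnorm_nonneg[of "s - v"] unfolding \<mu>_def by linarith
  then have "\<phi> powr \<mu> \<le> \<phi> powr (lnorm (s - t) / 4 + lnorm (s - v) / 4)"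
    using phi_pos phi_less_1 by (intro powr_mono') auto
  then have le: "\<phi> powr \<mu> \<le> \<phi> powr (lnorm (s - t) / 4) * (\<phi> powr (1/4)) powr lnorm (s - v)"
    by (simp add: powr_add powr_powr)
  have "prob {\<omega> \<in> space M. x / \<phi> powr lnorm (s - v) < Z v \<omega> \<and> x / \<phi> powr lnorm (t - v) < Z v \<omega>}
      \<le> prob {\<omega> \<in> space M. x / \<phi> powr \<mu> < Z v \<omega>}"
    by (intro finite_measure_mono) (auto simp: \<mu>_def max_def)
  also have "\<dots> \<le> \<phi> powr \<mu> / x"
    using prob_Z_gt_le[of "x / \<phi> powr \<mu>" v] assms phi_pos by simp
  also have "\<dots> \<le> \<phi> powr (lnorm (s - t) / 4) / x * (\<phi> powr (1/4)) powr lnorm (s - v)"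
    using le assms by (simp add: field_simps)
  finally show ?thesis .
qed

text \<open>A double union bound over the sites \<open>v\<close> and \<open>w\<close> of the two
  responsible noise variables. Distinct sites are independent and sum to the square; the diagonal
  \<open>v = w\<close> is a single common shock and gives the second term.\<close>

lemma prob_shock_Int_le:
  assumes "0 < x"
  shows "prob (shock s x \<inter> shock t x) \<le>
    (geo_sum \<phi> / x)\<^sup>2 + \<phi> powr (lnorm (s - t) / 4) / x * geo_sum (\<phi> powr (1/4))"
proof -
  define A where "A s v = {\<omega> \<in> space M. x / \<phi> powr lnorm (s - v) < Z v \<omega>}" for s v
  define g where "g s v = \<phi> powr lnorm (s - v) / x" for s v
  define d where "d v = \<phi> powr (lnorm (s - t) / 4) / x * (\<phi> powr (1/4)) powr lnorm (s - v)" for v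
  have [measurable]: "A s v \<in> events" for s v unfolding A_def by measurable
  have g_nonneg: "0 \<le> g s v" for s v using assms by (simp add: g_def)
  have d_nonneg: "0 \<le> d v" for v using assms by (simp add: d_def)
  have g_sum: "(g s has_sum geo_sum \<phi> / x) UNIV" for s
    using has_sum_cmult_right[OF has_sum_powr_lnorm_shift[OF phi_pos phi_less_1, of s], of "1 / x"]
    by (simp add: g_def[abs_def])
  have d_sum: "(d has_sum \<phi> powr (lnorm (s - t) / 4) / x * geo_sum (\<phi> powr (1/4))) UNIV"
    unfolding d_def using phi_pos phi_less_1
    by (intro has_sum_cmult_right has_sum_powr_lnorm_shift) (auto simp: powr01_less_one)
  \<comment> \<open>A uniform formula for both cases lets the product part be summed over all pairs,
    the diagonal included.\<close>
  have pair: "prob (A s v \<inter> A t w) \<le> g s v * g t w + (if w = v then d v else 0)" for v w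
  proof (cases "v = w")
    case True
    have "A s v \<inter> A t w = {\<omega> \<in> space M. x / \<phi> powr lnorm (s - v) < Z v \<omega> \<and> x / \<phi> powr lnorm (t - v) < Z v \<omega>}"
      unfolding A_def True by auto
    then have "prob (A s v \<inter> A t w) \<le> d v" using prob_single_shock_le[OF assms, of s v t] by (simp add: d_def)
    then show ?thesis using True g_nonneg[of s v] g_nonneg[of t w] by (simp add: add_increasing)
  next
    case False
    have "A s v \<inter> A t w = {\<omega> \<in> space M. x / \<phi> powr lnorm (s - v) < Z v \<omega> \<and> x / \<phi> powr lnorm (t - w) < Z w \<omega>}"
      unfolding A_def by auto
    then show ?thesis
      using prob_two_Z_gt_le[OF _ _ False, of "x / \<phi> powr lnorm (s - v)" "x / \<phi> powr lnorm (t - w)"]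
        False assms phi_pos by (simp add: g_def)
  qed
  have row: "prob (\<Union>w. A s v \<inter> A t w) \<le> g s v * (geo_sum \<phi> / x) + d v" for v
  proof (rule prob_UN_le_has_sum)
    have "((\<lambda>w. if w = v then d v else 0) has_sum d v) UNIV"
      using has_sum_finite_neutralI[of "{v}" UNIV "\<lambda>w. if w = v then d v else 0" "d v"] by simp
    then show "((\<lambda>w. g s v * g t w + (if w = v then d v else 0)) has_sum g s v * (geo_sum \<phi> / x) + d v) UNIV"
      by (intro has_sum_add has_sum_cmult_right g_sum)
  qed (use pair in auto)
  have "prob (\<Union>v. \<Union>w. A s v \<inter> A t w) \<le> geo_sum \<phi> / x * (geo_sum \<phi> / x) +
      \<phi> powr (lnorm (s - t) / 4) / x * geo_sum (\<phi> powr (1/4))"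
  proof (rule prob_UN_le_has_sum[OF _ row])
    show "((\<lambda>v. g s v * (geo_sum \<phi> / x) + d v) has_sum geo_sum \<phi> / x * (geo_sum \<phi> / x) +
        \<phi> powr (lnorm (s - t) / 4) / x * geo_sum (\<phi> powr (1/4))) UNIV"
      by (intro has_sum_add has_sum_cmult_left g_sum d_sum)
  qed auto
  moreover have "shock s x \<inter> shock t x = (\<Union>v. \<Union>w. A s v \<inter> A t w)"
    unfolding shock_def A_def by blast
  ultimately show ?thesis by (simp add: power2_eq_square)
qed

text \<open>Where the family is bounded, its supremum is at least \<open>Z s \<omega> > 0\<close>,
  so the absolute value disappears and some term exceeds \<open>x\<close>. Where it is unbounded,
  some term exceeds \<open>x\<close> whatever value the real supremum takes.\<close>

lemma abs_max_moving_gt_imp_shock: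
  assumes "\<omega> \<in> space M" "\<And>s. 0 < Z s \<omega>" "0 < x" "x < \<bar>max_moving \<phi> Z s \<omega>\<bar>"
  shows "\<omega> \<in> shock s x"
proof (cases "bdd_above (range (\<lambda>u. \<phi> powr lnorm u * Z (s - u) \<omega>))")
  case True
  have "\<phi> powr lnorm 0 * Z (s - 0) \<omega> \<le> max_moving \<phi> Z s \<omega>"
    unfolding max_moving_def by (rule cSUP_upper[OF _ True]) simp
  then have "0 < max_moving \<phi> Z s \<omega>" using assms(2)[of s] phi_pos by simp
  then have "x < max_moving \<phi> Z s \<omega>" using assms by simp
  then obtain u where "x < \<phi> powr lnorm u * Z (s - u) \<omega>"
    unfolding max_moving_def using less_cSUP_iff[OF _ True] by auto
  then show ?thesis using assms(1) shockI by blast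
next
  case False
  obtain u where "x < \<phi> powr lnorm u * Z (s - u) \<omega>"
    using not_bdd_above_rangeD[OF False] by blast
  then show ?thesis using assms(1) shockI by blast
qed

text \<open>An unbounded family produces shocks at every level \<open>Suc n\<close>, and the
  probability of such a shock is of order \<open>1 / Suc n\<close>.\<close>

lemma AE_bdd_above: "AE \<omega> in M. bdd_above (range (\<lambda>u. \<phi> powr lnorm u * Z (s - u) \<omega>))"
proof -
  define N where "N = (\<Inter>n::nat. shock s (Suc n))"
  have [measurable]: "N \<in> events" unfolding N_def by measurable
  have "prob N \<le> 0"
  proof (rule LIMSEQ_le_const)
    have "(\<lambda>n. inverse (real (Suc n)) * geo_sum \<phi>) \<longlonglongrightarrow> 0 * geo_sum \<phi>"
      by (intro tendsto_intros LIMSEQ_inverse_real_of_nat)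
    then show "(\<lambda>n. 1 / real (Suc n) * geo_sum \<phi>) \<longlonglongrightarrow> 0" by (simp add: inverse_eq_divide)
    have "prob N \<le> 1 / real (Suc n) * geo_sum \<phi>" for n
    proof -
      have "prob N \<le> prob (shock s (Suc n))" unfolding N_def by (intro finite_measure_mono) auto
      also have "\<dots> \<le> 1 / real (Suc n) * geo_sum \<phi>" by (rule prob_shock_le) simp
      finally show ?thesis .
    qed
    then show "\<exists>m. \<forall>n\<ge>m. prob N \<le> 1 / real (Suc n) * geo_sum \<phi>" by blast
  qed
  then have "prob N = 0" by (simp add: measure_le_0_iff)
  then have "AE \<omega> in M. \<omega> \<notin> N" by (subst (asm) prob_eq_0) auto
  then show ?thesis
  proof (rule AE_mp, intro AE_I2 impI)
    fix \<omega> assume \<omega>: "\<omega> \<in> space M" "\<omega> \<notin> N"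
    show "bdd_above (range (\<lambda>u. \<phi> powr lnorm u * Z (s - u) \<omega>))"
    proof (rule ccontr)
      assume *: "\<not> ?thesis"
      have "\<omega> \<in> shock s (Suc n)" for n
      proof -
        obtain u where "real (Suc n) < \<phi> powr lnorm u * Z (s - u) \<omega>"
          using not_bdd_above_rangeD[OF *] by blast
        then show ?thesis using \<omega>(1) shockI by blast
      qed
      then show False using \<omega>(2) by (simp add: N_def)
    qed
  qed
qed

lemma measurable_max_moving [measurable]: "max_moving \<phi> Z s \<in> borel_measurable M"
proof -
  define f where "f u \<omega> = \<phi> powr lnorm u * Z (s - u) \<omega>" for u \<omega>
  have f[measurable]: "f u \<in> borel_measurable M" for u unfolding f_def by measurable
  \<comment> \<open>Boundedness written with countable quantifiers only, hence a measurable
    predicate. \<open>borel_measurable_cSUP\<close> is then applied to a family made constant where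
    \<open>P\<close> fails, so that it is bounded at every point.\<close>
  define P where "P \<omega> \<longleftrightarrow> (\<exists>k::nat. \<forall>u. f u \<omega> \<le> real k)" for \<omega>
  have [measurable]: "Measurable.pred M P" unfolding P_def by measurable
  have P_iff: "P \<omega> \<longleftrightarrow> bdd_above (range (\<lambda>u. f u \<omega>))" for \<omega>
    unfolding P_def bdd_above_def by (auto, meson order_trans real_arch_simple)
  text \<open>Where the supremum is infinite, the real-valued one is the junk value
    \<open>LEAST z. False\<close>.\<close>
  have "(\<lambda>\<omega>. SUP u. if P \<omega> then f u \<omega> else (LEAST z::real. False)) \<in> borel_measurable M"
  proof (rule borel_measurable_cSUP)
    show "bdd_above (range (\<lambda>u. if P \<omega> then f u \<omega> else (LEAST z::real. False)))" for \<omega>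
      using P_iff[of \<omega>] by (cases "P \<omega>") auto
  qed auto
  moreover have "(SUP u. if P \<omega> then f u \<omega> else (LEAST z::real. False)) = max_moving \<phi> Z s \<omega>" for \<omega>
  proof (cases "P \<omega>")
    case True
    then show ?thesis by (simp add: max_moving_def f_def)
  next
    case False
    then have "(\<forall>v\<in>range (\<lambda>u. f u \<omega>). v \<le> z) \<longleftrightarrow> False" for z
      unfolding P_iff bdd_above_def by blast
    then have "(SUP u. f u \<omega>) = (LEAST z::real. False)"
      by (simp only: Sup_real_def)
    then show ?thesis using False by (simp add: max_moving_def f_def)
  qed
  ultimately show ?thesis by (simp cong: measurable_cong)
qed

text \<open>Lag 0 has weight 1, so the field dominates the noise at the same site wherever the
  supremum is finite. This lower bound on the tail later forces the thresholds to grow.\<close>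

lemma prob_abs_max_moving_gt_ge:
  "prob {\<omega> \<in> space M. x < Z s \<omega>} \<le> prob {\<omega> \<in> space M. x < \<bar>max_moving \<phi> Z s \<omega>\<bar>}"
proof (rule finite_measure_mono_AE)
  show "AE \<omega> in M. \<omega> \<in> {\<omega> \<in> space M. x < Z s \<omega>} \<longrightarrow> \<omega> \<in> {\<omega> \<in> space M. x < \<bar>max_moving \<phi> Z s \<omega>\<bar>}"
    using AE_bdd_above[of s]
  proof (rule AE_mp, intro AE_I2 impI)
    fix \<omega> assume bdd: "bdd_above (range (\<lambda>u. \<phi> powr lnorm u * Z (s - u) \<omega>))"
      and \<omega>: "\<omega> \<in> {\<omega> \<in> space M. x < Z s \<omega>}"
    have "\<phi> powr lnorm 0 * Z (s - 0) \<omega> \<le> max_moving \<phi> Z s \<omega>"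
      unfolding max_moving_def by (rule cSUP_upper[OF _ bdd]) simp
    then show "\<omega> \<in> {\<omega> \<in> space M. x < \<bar>max_moving \<phi> Z s \<omega>\<bar>}" using \<omega> phi_pos by auto
  qed
qed measurable

text \<open>For negative \<open>\<gamma>\<close> the ball is empty and \<^const>\<open>exceed\<close> compares \<open>x\<close> with the junk value
  \<open>Max {}\<close>.\<close>

lemma prob_exceed_pair_le:
  assumes "0 < x" "Max ({}::real set) \<le> x"
  shows "prob {\<omega> \<in> space M. exceed (max_moving \<phi> Z) (lball \<gamma>) x \<omega> \<and>
                            exceed (max_moving \<phi> Z) ((\<lambda>s. s + l) ` lball \<gamma>) x \<omega>}
    \<le> (real (card (lball \<gamma>)))\<^sup>2 *
       ((geo_sum \<phi> / x)\<^sup>2 + \<phi> powr ((lnorm l - 2 * \<gamma>) / 4) / x * geo_sum (\<phi> powr (1/4)))"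
    (is "prob ?E \<le> _ * ?b")
proof -
  let ?B = "lball \<gamma>"
  have exceedD: "\<exists>s\<in>B. x < \<bar>max_moving \<phi> Z s \<omega>\<bar>"
    if "exceed (max_moving \<phi> Z) B x \<omega>" "finite B" for B \<omega>
  proof -
    have "B \<noteq> {}" using that(1) assms(2) by (auto simp: exceed_def)
    then show ?thesis using that by (simp add: exceed_def Max_gr_iff)
  qed
  define U where "U = (\<Union>p\<in>?B \<times> ?B. shock (fst p) x \<inter> shock (snd p + l) x)"
  have "prob ?E \<le> prob U"
  proof (rule finite_measure_mono_AE)
    show "AE \<omega> in M. \<omega> \<in> ?E \<longrightarrow> \<omega> \<in> U"
      using AE_Z_pos
    proof (rule AE_mp, intro AE_I2 impI)
      fix \<omega> assume Z: "\<forall>s. 0 < Z s \<omega>" and \<omega>: "\<omega> \<in> ?E"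
      obtain s where s: "s \<in> ?B" "x < \<bar>max_moving \<phi> Z s \<omega>\<bar>" using exceedD[of ?B \<omega>] \<omega> by auto
      obtain t where t: "t \<in> ?B" "x < \<bar>max_moving \<phi> Z (t + l) \<omega>\<bar>"
        using exceedD[of "(\<lambda>s. s + l) ` ?B" \<omega>] \<omega> by auto
      have "\<omega> \<in> shock s x \<inter> shock (t + l) x"
        using abs_max_moving_gt_imp_shock[OF _ _ assms(1) s(2)]
          abs_max_moving_gt_imp_shock[OF _ _ assms(1) t(2)] \<omega> Z by simp
      then show "\<omega> \<in> U" unfolding U_def using s t by (intro UN_I[of "(s, t)"]) auto
    qed
    show "U \<in> events" unfolding U_def by (intro sets.finite_UN) auto
  qed
  also have "\<dots> \<le> (\<Sum>p\<in>?B \<times> ?B. prob (shock (fst p) x \<inter> shock (snd p + l) x))"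
    unfolding U_def by (intro finite_measure_subadditive_finite) auto
  also have "\<dots> \<le> (\<Sum>p\<in>?B \<times> ?B. ?b)"
  proof (rule sum_mono)
    fix p assume "p \<in> ?B \<times> ?B"
    then have p: "lnorm (fst p) \<le> \<gamma>" "lnorm (snd p) \<le> \<gamma>" by (auto simp: lball_def)
    \<comment> \<open>Both points of \<open>p\<close> lie within \<gamma> of the origin, so shifting
      one of them by \<open>l\<close> separates them by at least
      \<open>lnorm l - 2 * \<gamma>\<close>.\<close>
    have "l = (snd p + l - fst p) + (fst p - snd p)" by simp
    then have "lnorm l \<le> lnorm (snd p + l - fst p) + lnorm (fst p - snd p)"
      using lnorm_triangle by metis
    then have "lnorm l - 2 * \<gamma> \<le> lnorm (fst p - (snd p + l))"
      using lnorm_triangle[of "fst p" "- snd p"] p lnorm_minus_commute[of "fst p" "snd p + l"] by simp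
    then have "\<phi> powr (lnorm (fst p - (snd p + l)) / 4) \<le> \<phi> powr ((lnorm l - 2 * \<gamma>) / 4)"
      using phi_pos phi_less_1 by (intro powr_mono') auto
    then have "\<phi> powr (lnorm (fst p - (snd p + l)) / 4) / x * geo_sum (\<phi> powr (1/4))
        \<le> \<phi> powr ((lnorm l - 2 * \<gamma>) / 4) / x * geo_sum (\<phi> powr (1/4))"
      using assms by (intro mult_right_mono divide_right_mono geo_sum_nonneg) auto
    then show "prob (shock (fst p) x \<inter> shock (snd p + l) x) \<le> ?b"
      using prob_shock_Int_le[OF assms(1), of "fst p" "snd p + l"] by linarith
  qed
  also have "\<dots> = (real (card ?B))\<^sup>2 * ?b"
    by (simp add: card_cartesian_product power2_eq_square)
  finally show ?thesis .
qed

end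

section \<open>Mixing coefficients\<close>

text \<open>Induction over the generated sigma-algebra: agreeing off \<open>N\<close> with an event
  generated by \<open>Y\<close> holds for the generators and survives complements and countable
  unions.\<close>

lemma gen_sigma_transfer:
  assumes "E \<in> gen_sigma M X S"
    and eq: "\<And>s \<omega>. s \<in> S \<Longrightarrow> \<omega> \<in> space M - N \<Longrightarrow> X s \<omega> = Y s \<omega>"
  shows "\<exists>E'\<in>gen_sigma M Y S. E - N = E' - N"
  using assms(1) unfolding gen_sigma_def
proof (induction rule: sigma_sets.induct)
  case (Basic a)
  then obtain s A where s: "s \<in> S" "A \<in> sets borel" "a = X s -` A \<inter> space M" by auto
  then have "Y s -` A \<inter> space M \<in> sigma_sets (space M) (\<Union>s\<in>S. {Y s -` A \<inter> space M |A. A \<in> sets borel})"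
    by (intro sigma_sets.Basic) auto
  moreover have "a - N = (Y s -` A \<inter> space M) - N" using s eq[OF s(1)] by auto
  ultimately show ?case by blast
next
  case Empty
  then show ?case by (auto intro: sigma_sets.Empty)
next
  case (Compl a)
  then obtain a' where a': "a' \<in> sigma_sets (space M) (\<Union>s\<in>S. {Y s -` A \<inter> space M |A. A \<in> sets borel})"
    "a - N = a' - N" by auto
  then have "(space M - a) - N = (space M - a') - N" by blast
  with a'(1) show ?case by (intro bexI[of _ "space M - a'"] sigma_sets.Compl)
next
  case (Union a)
  have "\<forall>i. \<exists>b. b \<in> sigma_sets (space M) (\<Union>s\<in>S. {Y s -` A \<inter> space M |A. A \<in> sets borel})
      \<and> a i - N = b - N"
    using Union.IH by blast
  from choice[OF this] obtain a' where
    a': "\<And>i. a' i \<in> sigma_sets (space M) (\<Union>s\<in>S. {Y s -` A \<inter> space M |A. A \<in> sets borel})"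
    "\<And>i. a i - N = a' i - N" by blast
  have "(\<Union>i. a i) - N = (\<Union>i. a i - N)" by blast
  also have "\<dots> = (\<Union>i. a' i) - N" by (simp add: a'(2))
  finally show ?case using a'(1) by (intro bexI[of _ "\<Union>i. a' i"] sigma_sets.Union)
qed

text \<open>\<open>N\<close> is kept apart from \<open>M\<close> for two uses: with
  \<open>N = M\<close> it makes generated sets events, and with a sub-sigma-algebra generated by
  noise it yields an inclusion of generated sigma-algebras.\<close>

lemma gen_sigma_subset_sets:
  assumes "space N = space M" "\<And>s. s \<in> S \<Longrightarrow> Y s \<in> borel_measurable N"
  shows "gen_sigma M Y S \<subseteq> sets N"
proof -
  have "sigma_sets (space N) (\<Union>s\<in>S. {Y s -` A \<inter> space N |A. A \<in> sets borel}) \<subseteq> sets N"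
    using assms(2) by (intro sets.sigma_sets_subset) (auto intro: measurable_sets)
  then show ?thesis using assms(1) by (simp add: gen_sigma_def)
qed

lemma empty_in_gen_sigma: "{} \<in> gen_sigma M X S"
  unfolding gen_sigma_def by (rule sigma_sets.Empty)

lemma (in prob_space) abs_prob_diff_le:
  assumes "E - N = E' - N" "E \<in> events" "E' \<in> events" "N \<in> events"
  shows "\<bar>prob E - prob E'\<bar> \<le> prob N"
proof -
  have "prob A \<le> prob B + prob N" if "A - N = B - N" "A \<in> events" "B \<in> events" for A B
  proof -
    have "prob A \<le> prob (B \<union> N)" using that assms by (intro finite_measure_mono) auto
    also have "\<dots> \<le> prob B + prob N" using that assms by (intro measure_Un_le) auto
    finally show ?thesis .
  qed
  from this[OF assms(1-3)] this[OF assms(1)[symmetric] assms(3,2)] show ?thesis by linarith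
qed

text \<open>Each of the three probabilities changes by at most \<open>prob N\<close> under the replacement.\<close>

lemma (in prob_space) abs_prob_Int_minus_mult_le:
  assumes "E - N = E' - N" "F - N = F' - N"
    and ev: "E \<in> events" "E' \<in> events" "F \<in> events" "F' \<in> events" "N \<in> events"
    and indep: "prob (E' \<inter> F') = prob E' * prob F'"
  shows "\<bar>prob (E \<inter> F) - prob E * prob F\<bar> \<le> 3 * prob N"
proof -
  have "\<bar>prob (E \<inter> F) - prob (E' \<inter> F')\<bar> \<le> prob N"
    using assms by (intro abs_prob_diff_le) auto
  moreover have "\<bar>prob E' * (prob F' - prob F)\<bar> \<le> 1 * prob N"
    unfolding abs_mult using abs_prob_diff_le[of F N F'] assms
    by (intro mult_mono) (auto simp: abs_minus_commute)
  moreover have "\<bar>(prob E' - prob E) * prob F\<bar> \<le> prob N * 1"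
    unfolding abs_mult using abs_prob_diff_le[of E N E'] assms
    by (intro mult_mono) (auto simp: abs_minus_commute)
  moreover have "prob (E \<inter> F) - prob E * prob F = (prob (E \<inter> F) - prob (E' \<inter> F')) +
      prob E' * (prob F' - prob F) + (prob E' - prob E) * prob F"
    by (simp add: indep algebra_simps)
  ultimately show ?thesis by linarith
qed

text \<open>Grouping of independent variables into disjoint blocks: the generators of each single
  variable are stable under intersection, so independence extends to the sigma-algebras of the
  blocks.\<close>

lemma (in prob_space) prob_Int_gen_sigma_disjoint:
  assumes "indep_vars (\<lambda>_. borel) Z UNIV" "V \<inter> W = {}"
    and "E \<in> gen_sigma M Z V" "F \<in> gen_sigma M Z W"
  shows "prob (E \<inter> F) = prob E * prob F"
proof -
  define G where "G v = {Z v -` A \<inter> space M |A. A \<in> sets borel}" for v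
  \<comment> \<open>The two blocks are indexed by the booleans to fit the family version
    \<open>indep_sets_collect_sigma\<close>.\<close>
  define I where "I b = (if b then V else W)" for b
  have "indep_sets G UNIV" using assms(1) unfolding indep_vars_def2 G_def by auto
  then have "indep_sets (\<lambda>b. sigma_sets (space M) (\<Union>v\<in>I b. G v)) UNIV"
  proof (intro indep_sets_collect_sigma)
    show "indep_sets G (\<Union>j\<in>UNIV. I j)" if "indep_sets G UNIV"
      using that by (rule indep_sets_mono_index[rotated]) simp
    show "disjoint_family_on I UNIV"
      using assms(2) by (auto simp: disjoint_family_on_def I_def)
    show "Int_stable (G v)" for v
    proof (rule Int_stableI)
      fix a b assume "a \<in> G v" "b \<in> G v"
      then obtain A B where "A \<in> sets borel" "B \<in> sets borel"
        "a = Z v -` A \<inter> space M" "b = Z v -` B \<inter> space M" by (auto simp: G_def)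
      then show "a \<inter> b \<in> G v" unfolding G_def by (intro CollectI exI[of _ "A \<inter> B"]) auto
    qed
  qed
  then have "prob (\<Inter>b\<in>UNIV. if b then E else F) = (\<Prod>b\<in>UNIV. prob (if b then E else F))"
    by (rule indep_setsD) (use assms in \<open>auto simp: gen_sigma_def I_def G_def\<close>)
  then show ?thesis by (simp add: UNIV_bool ac_simps)
qed

section \<open>Truncation of the moving maximum and the resulting mixing bounds\<close>

context frechet_field
begin

text \<open>The inequality is strict so that balls of radius \<open>r / 2\<close> around sites at
  distance exactly \<open>r\<close> are still disjoint.\<close>

definition truncated :: "real \<Rightarrow> int \<times> int \<Rightarrow> 'a \<Rightarrow> real" where
  "truncated \<rho> s \<omega> = (SUP u\<in>{u. lnorm u < \<rho>}. \<phi> powr lnorm u * Z (s - u) \<omega>)"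

text \<open>Far terms are compared with the lag-0 term \<open>Z s \<omega>\<close>, which the
  truncated maximum contains; unless one of them beats it, dropping them changes nothing.\<close>

definition far_shock :: "real \<Rightarrow> int \<times> int \<Rightarrow> 'a set" where
  "far_shock \<rho> s = (\<Union>u. {\<omega> \<in> space M. \<rho> \<le> lnorm u \<and> Z s \<omega> < \<phi> powr lnorm u * Z (s - u) \<omega>})"

lemma finite_lnorm_less: "finite {u. lnorm u < \<rho>}"
  by (rule finite_subset[OF _ finite_lball[of \<rho>]]) (auto simp: lball_def)

lemma far_shock_events [measurable]: "far_shock \<rho> s \<in> events"
  unfolding far_shock_def by measurable

lemma max_moving_eq_truncated:
  assumes "0 < \<rho>" "\<omega> \<in> space M - far_shock \<rho> s"
  shows "max_moving \<phi> Z s \<omega> = truncated \<rho> s \<omega>"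
proof -
  define f where "f u = \<phi> powr lnorm u * Z (s - u) \<omega>" for u
  have fin: "finite (f ` {u. lnorm u < \<rho>})" using finite_lnorm_less by simp
  have f0: "f 0 = Z s \<omega>" using phi_pos by (simp add: f_def)
  have near: "f u \<le> (SUP u\<in>{u. lnorm u < \<rho>}. f u)" if "lnorm u < \<rho>" for u
    using that fin by (intro cSUP_upper bdd_above_finite) auto
  have le: "f u \<le> (SUP u\<in>{u. lnorm u < \<rho>}. f u)" for u
  proof (cases "lnorm u < \<rho>")
    case False
    have "\<not> (\<rho> \<le> lnorm u \<and> Z s \<omega> < f u)"
      using assms(2) unfolding far_shock_def f_def by blast
    with False have "f u \<le> f 0" by (simp add: f0)
    also have "\<dots> \<le> (SUP u\<in>{u. lnorm u < \<rho>}. f u)" using assms(1) by (intro near) simp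
    finally show ?thesis .
  qed (rule near)
  have "(SUP u. f u) = (SUP u\<in>{u. lnorm u < \<rho>}. f u)"
  proof (rule antisym)
    show "(SUP u. f u) \<le> (SUP u\<in>{u. lnorm u < \<rho>}. f u)" using le by (intro cSUP_least) auto
    \<comment> \<open>The finite near maximum bounds the whole family, so the real supremum is a
      genuine one here.\<close>
    have "bdd_above (range f)" using le by (intro bdd_aboveI2)
    moreover have "0 \<in> {u. lnorm u < \<rho>}" using assms(1) by simp
    ultimately show "(SUP u\<in>{u. lnorm u < \<rho>}. f u) \<le> (SUP u. f u)"
      by (intro cSUP_subset_mono) blast+
  qed
  then show ?thesis by (simp add: max_moving_def truncated_def f_def)
qed

text \<open>If \<open>Z s\<close> exceeds \<open>q\<close>, then \<open>Z t\<close> must exceed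
  \<open>1 / q\<close>. Writing the factor as a square balances the two alternatives: each has
  probability at most \<open>q\<close>.\<close>

lemma prob_scaled_Z_gt_Z_le:
  assumes "0 < q"
  shows "prob {\<omega> \<in> space M. Z s \<omega> < q\<^sup>2 * Z t \<omega>} \<le> 2 * q"
proof -
  have "prob {\<omega> \<in> space M. Z s \<omega> < q\<^sup>2 * Z t \<omega>}
      \<le> prob ({\<omega> \<in> space M. Z s \<omega> \<le> q} \<union> {\<omega> \<in> space M. 1 / q < Z t \<omega>})"
  proof (intro finite_measure_mono subsetI)
    fix \<omega> assume \<omega>: "\<omega> \<in> {\<omega> \<in> space M. Z s \<omega> < q\<^sup>2 * Z t \<omega>}"
    show "\<omega> \<in> {\<omega> \<in> space M. Z s \<omega> \<le> q} \<union> {\<omega> \<in> space M. 1 / q < Z t \<omega>}"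
    proof (cases "Z s \<omega> \<le> q")
      case False
      then have "q * 1 < q * (q * Z t \<omega>)" using \<omega> by (simp add: power2_eq_square mult.assoc)
      then have "1 < q * Z t \<omega>" using assms by (simp only: mult_less_cancel_left_pos)
      then show ?thesis using \<omega> assms by (simp add: field_simps)
    qed (use \<omega> in auto)
  qed measurable
  also have "\<dots> \<le> prob {\<omega> \<in> space M. Z s \<omega> \<le> q} + prob {\<omega> \<in> space M. 1 / q < Z t \<omega>}"
    by (intro measure_Un_le) auto
  also have "\<dots> \<le> q + q"
    using prob_Z_le[OF assms, of s] exp_minus_inverse_le[OF assms] prob_Z_gt_le[of "1 / q" t] assms
    by simp
  finally show ?thesis by simp
qed

lemma prob_far_shock_le:
  "prob (far_shock \<rho> s) \<le> 2 * geo_sum (\<phi> powr (1/4)) * \<phi> powr (\<rho> / 4)"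
proof -
  have "prob (far_shock \<rho> s) \<le> (2 * \<phi> powr (\<rho> / 4)) * geo_sum (\<phi> powr (1/4))"
    unfolding far_shock_def
  proof (rule prob_UN_le_has_sum)
    show "((\<lambda>u. 2 * \<phi> powr (\<rho> / 4) * (\<phi> powr (1/4)) powr lnorm u) has_sum
        (2 * \<phi> powr (\<rho> / 4)) * geo_sum (\<phi> powr (1/4))) UNIV"
      using phi_pos phi_less_1
      by (intro has_sum_cmult_right has_sum_powr_lnorm) (auto simp: powr01_less_one)
    fix u
    let ?A = "{\<omega> \<in> space M. \<rho> \<le> lnorm u \<and> Z s \<omega> < \<phi> powr lnorm u * Z (s - u) \<omega>}"
    show "?A \<in> events" by measurable
    show "prob ?A \<le> 2 * \<phi> powr (\<rho> / 4) * (\<phi> powr (1/4)) powr lnorm u"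
    proof (cases "\<rho> \<le> lnorm u")
      case True
      have "(\<phi> powr (lnorm u / 2))\<^sup>2 = \<phi> powr lnorm u"
        by (simp add: power2_eq_square flip: powr_add)
      \<comment> \<open>Half of the exponent remains after the square root. It is split into
        quarters: one is bounded through \<open>\<rho> \<le> lnorm u\<close>, the other is summed
        over \<open>u\<close>.\<close>
      then have "prob ?A \<le> 2 * \<phi> powr (lnorm u / 2)"
        using prob_scaled_Z_gt_Z_le[of "\<phi> powr (lnorm u / 2)" s "s - u"] phi_pos True by simp
      also have "\<dots> \<le> 2 * \<phi> powr (\<rho> / 4 + lnorm u / 4)"
        using phi_pos phi_less_1 True by (intro mult_left_mono powr_mono') auto
      finally show ?thesis by (simp add: powr_add powr_powr)
    qed simp
  qed
  then show ?thesis by (simp add: mult.commute mult.left_commute)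
qed

text \<open>Each truncated value is a finite maximum of noise at sites within \<rho>. Measurability
  is checked in an auxiliary measure space whose sigma-algebra is the one generated by that
  noise.\<close>

lemma gen_sigma_truncated_subset:
  "gen_sigma M (truncated \<rho>) S \<subseteq> gen_sigma M Z (\<Union>s\<in>S. {v. lnorm (s - v) < \<rho>})"
proof -
  define V where "V = (\<Union>s\<in>S. {v. lnorm (s - v) < \<rho>})"
  define N where "N = sigma (space M) (\<Union>v\<in>V. {Z v -` A \<inter> space M |A. A \<in> sets borel})"
  have sub: "(\<Union>v\<in>V. {Z v -` A \<inter> space M |A. A \<in> sets borel}) \<subseteq> Pow (space M)" by auto
  then have N: "space N = space M" "sets N = gen_sigma M Z V"
    by (simp_all add: N_def gen_sigma_def space_measure_of sets_measure_of)
  have Z: "Z v \<in> borel_measurable N" if "v \<in> V" for v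
  proof (rule measurableI)
    fix A :: "real set" assume "A \<in> sets borel"
    then show "Z v -` A \<inter> space N \<in> sets N"
      using that unfolding N gen_sigma_def by (intro sigma_sets.Basic) auto
  qed auto
  have "gen_sigma M (truncated \<rho>) S \<subseteq> sets N"
  proof (rule gen_sigma_subset_sets[OF N(1)])
    fix s assume s: "s \<in> S"
    show "truncated \<rho> s \<in> borel_measurable N"
      unfolding truncated_def[abs_def]
    proof (rule borel_measurable_cSUP)
      show "(\<lambda>\<omega>. \<phi> powr lnorm u * Z (s - u) \<omega>) \<in> borel_measurable N" if "u \<in> {u. lnorm u < \<rho>}" for u
        using that s by (intro borel_measurable_times borel_measurable_const Z)
          (auto simp: V_def intro!: bexI[of _ s])
    qed (use finite_lnorm_less in \<open>auto intro: countable_finite bdd_above_finite\<close>)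
  qed
  then show ?thesis by (simp add: N V_def)
qed

text \<open>Truncation at radius \<open>r / 2\<close> makes the noise sites used by the two fields
  disjoint, hence the replaced events independent. The error \<open>3 * prob N\<close> and the
  factor 2 in the far-shock bound give the constant 6; the exponent is
  \<open>\<rho> / 4 = r / 8\<close>.\<close>

lemma abs_prob_mixing_le:
  assumes fin: "finite S" "finite T" and dist: "ereal r \<le> lattice_dist S T" and r: "0 < r"
    and E: "E \<in> gen_sigma M (max_moving \<phi> Z) S" and F: "F \<in> gen_sigma M (max_moving \<phi> Z) T"
  shows "\<bar>prob (E \<inter> F) - prob E * prob F\<bar>
    \<le> 6 * geo_sum (\<phi> powr (1/4)) * real (card S + card T) * \<phi> powr (r / 8)"
proof -
  define \<rho> where "\<rho> = r / 2"
  have \<rho>: "0 < \<rho>" using r by (simp add: \<rho>_def)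
  define N where "N = (\<Union>s\<in>S \<union> T. far_shock \<rho> s)"
  have N: "N \<in> events" unfolding N_def using fin by (intro sets.finite_UN) auto
  define V where "V S = (\<Union>s\<in>S. {v. lnorm (s - v) < \<rho>})" for S
  have V_disj: "V S \<inter> V T = {}"
  proof (rule ccontr)
    assume "V S \<inter> V T \<noteq> {}"
    then obtain v s t where v: "s \<in> S" "t \<in> T" "lnorm (s - v) < \<rho>" "lnorm (t - v) < \<rho>"
      by (auto simp: V_def)
    have "lattice_dist S T \<le> ereal (lnorm (s - t))"
      unfolding lattice_dist_def using v by (intro INF_lower2[of "(s, t)"]) auto
    then have "r \<le> lnorm (s - t)" using dist order_trans by fastforce
    then show False using lnorm_triangle_sub[of s t v] v by (simp add: \<rho>_def)
  qed
  have trunc: "\<exists>E'\<in>gen_sigma M Z (V S'). E - N = E' - N"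
    if "E \<in> gen_sigma M (max_moving \<phi> Z) S'" "S' \<subseteq> S \<union> T" for S' E
  proof -
    have "max_moving \<phi> Z s \<omega> = truncated \<rho> s \<omega>" if "s \<in> S'" "\<omega> \<in> space M - N" for s \<omega>
      using that \<open>S' \<subseteq> S \<union> T\<close> by (intro max_moving_eq_truncated \<rho>) (auto simp: N_def)
    from gen_sigma_transfer[OF that(1), of N "truncated \<rho>", OF this]
    show ?thesis using gen_sigma_truncated_subset[of \<rho> S'] by (auto simp: V_def)
  qed
  obtain E' where E': "E' \<in> gen_sigma M Z (V S)" "E - N = E' - N" using trunc[OF E] by auto
  obtain F' where F': "F' \<in> gen_sigma M Z (V T)" "F - N = F' - N" using trunc[OF F] by auto
  have "gen_sigma M (max_moving \<phi> Z) S' \<subseteq> events" "gen_sigma M Z S' \<subseteq> events" for S'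
    by (intro gen_sigma_subset_sets; simp)+
  then have "\<bar>prob (E \<inter> F) - prob E * prob F\<bar> \<le> 3 * prob N"
    using prob_Int_gen_sigma_disjoint[OF indep_Z V_disj E'(1) F'(1)] E F E' F' N
    by (intro abs_prob_Int_minus_mult_le[of E N E' F F']) auto
  also have "prob N \<le> (\<Sum>s\<in>S \<union> T. prob (far_shock \<rho> s))"
    unfolding N_def using fin by (intro finite_measure_subadditive_finite) auto
  also have "\<dots> \<le> (\<Sum>s\<in>S \<union> T. 2 * geo_sum (\<phi> powr (1/4)) * \<phi> powr (r / 8))"
    using prob_far_shock_le[of \<rho>] by (intro sum_mono) (simp add: \<rho>_def)
  also have "\<dots> = real (card (S \<union> T)) * (2 * geo_sum (\<phi> powr (1/4)) * \<phi> powr (r / 8))" by simp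
  also have "\<dots> \<le> real (card S + card T) * (2 * geo_sum (\<phi> powr (1/4)) * \<phi> powr (r / 8))"
    using card_Un_le[of S T] geo_sum_nonneg by (intro mult_right_mono) auto
  finally show ?thesis by (simp add: algebra_simps)
qed

lemma mixing_coeff_bounds:
  assumes r: "0 < r"
  shows mixing_coeff_nonneg: "0 \<le> mixing_coeff M (max_moving \<phi> Z) j k r"
    and mixing_coeff_le: "mixing_coeff M (max_moving \<phi> Z) j k r
      \<le> 6 * geo_sum (\<phi> powr (1/4)) * real (j + k) * \<phi> powr (r / 8)"
proof -
  let ?X = "max_moving \<phi> Z"
  let ?b = "6 * geo_sum (\<phi> powr (1/4)) * real (j + k) * \<phi> powr (r / 8)"
  let ?P = "{(S, T). finite S \<and> card S \<le> j \<and> finite T \<and> card T \<le> k \<and> ereal r \<le> lattice_dist S T}"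
  define \<alpha> where "\<alpha> = (\<lambda>(S, T). alpha_mixing M (gen_sigma M ?X S) (gen_sigma M ?X T))"
  have coeff: "mixing_coeff M ?X j k r = (SUP p\<in>?P. \<alpha> p)"
    by (simp add: mixing_coeff_def \<alpha>_def)
  have le: "\<bar>prob (E \<inter> F) - prob E * prob F\<bar> \<le> ?b"
    if "(S, T) \<in> ?P" "E \<in> gen_sigma M ?X S" "F \<in> gen_sigma M ?X T" for S T E F
  proof -
    have "\<bar>prob (E \<inter> F) - prob E * prob F\<bar>
        \<le> 6 * geo_sum (\<phi> powr (1/4)) * real (card S + card T) * \<phi> powr (r / 8)"
      using that r by (intro abs_prob_mixing_le) auto
    also have "\<dots> \<le> ?b"
      using that geo_sum_nonneg by (intro mult_right_mono mult_left_mono) auto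
    finally show ?thesis .
  qed
  have \<alpha>_le: "\<alpha> p \<le> ?b" if "p \<in> ?P" for p
  proof (cases p)
    case (Pair S T)
    have "gen_sigma M ?X S \<times> gen_sigma M ?X T \<noteq> {}" using empty_in_gen_sigma by blast
    then show ?thesis
      using le[of S T] that unfolding Pair \<alpha>_def alpha_mixing_def by (auto intro!: cSUP_least)
  qed
  \<comment> \<open>The infimum over no pairs is \<infinity>, so this pair is always admissible. It
    makes the real supremum range over a nonempty set and supplies a non-negative member.\<close>
  have empty: "({}, {}) \<in> ?P" by (simp add: lattice_dist_def)
  show "mixing_coeff M ?X j k r \<le> ?b"
    unfolding coeff using empty \<alpha>_le by (intro cSUP_least) blast+
  have "0 \<le> \<alpha> ({}, {})"
    unfolding \<alpha>_def alpha_mixing_def prod.case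
  proof (rule cSUP_upper2[where x = "({}, {})"])
    show "bdd_above ((\<lambda>(E, F). \<bar>prob (E \<inter> F) - prob E * prob F\<bar>) ` (gen_sigma M ?X {} \<times> gen_sigma M ?X {}))"
      using le[OF empty] by (intro bdd_aboveI2[where M = ?b]) auto
  qed (auto intro: empty_in_gen_sigma)
  also have "\<dots> \<le> mixing_coeff M ?X j k r"
    unfolding coeff using empty \<alpha>_le by (intro cSUP_upper bdd_aboveI2[where M = ?b]) auto
  finally show "0 \<le> mixing_coeff M ?X j k r" .
qed

end

section \<open>Asymptotics\<close>

lemma powr_linear_tendsto_0:
  fixes \<phi> \<delta> :: real
  assumes "0 < \<phi>" "\<phi> < 1" "0 < \<delta>" "filterlim r at_top F"
  shows "((\<lambda>n. \<phi> powr (\<delta> * r n)) \<longlongrightarrow> 0) F"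
proof -
  have "\<delta> * ln \<phi> < 0" using assms by (simp add: mult_pos_neg)
  then have "filterlim (\<lambda>n. \<delta> * ln \<phi> * r n) at_bot F"
    using assms(4) by (rule filterlim_tendsto_neg_mult_at_bot[OF tendsto_const])
  then have "((\<lambda>n. exp (\<delta> * ln \<phi> * r n)) \<longlongrightarrow> 0) F"
    by (rule filterlim_compose[OF exp_at_bot])
  then show ?thesis using assms(1) by (simp add: powr_def mult.assoc mult.left_commute mult.commute)
qed

text \<open>The logarithm of the weight is negligible against \<open>r\<close>, so half of the
  exponential decay absorbs the weight and the other half tends to 0.\<close>

lemma mult_powr_tendsto_0:
  fixes \<phi> \<delta> :: real
  assumes "0 < \<phi>" "\<phi> < 1" "0 < \<delta>" "filterlim r at_top F"
    and "(\<lambda>n. ln (w n)) \<in> o[F](r)" and w: "eventually (\<lambda>n. 0 < w n) F"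
  shows "((\<lambda>n. w n * \<phi> powr (\<delta> * r n)) \<longlongrightarrow> 0) F"
proof (rule tendsto_sandwich)
  show "((\<lambda>n. 0) \<longlongrightarrow> (0::real)) F" by simp
  show "((\<lambda>n. \<phi> powr (\<delta> / 2 * r n)) \<longlongrightarrow> 0) F"
    using assms by (intro powr_linear_tendsto_0) auto
  show "eventually (\<lambda>n. 0 \<le> w n * \<phi> powr (\<delta> * r n)) F"
    using w by eventually_elim simp
  \<comment> \<open>Chosen so that \<open>exp (- e * r n)\<close> is exactly half of the decay;
    positive because \<open>ln \<phi> < 0\<close>.\<close>
  define e where "e = - (\<delta> / 2 * ln \<phi>)"
  have "0 < e" using assms by (simp add: e_def mult_pos_neg)
  then have "eventually (\<lambda>n. norm (ln (w n)) \<le> e * norm (r n)) F"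
    using assms(5) by (rule landau_o.smallD[rotated])
  moreover have "eventually (\<lambda>n. 0 \<le> r n) F" using assms(4) by (simp add: filterlim_at_top)
  ultimately show "eventually (\<lambda>n. w n * \<phi> powr (\<delta> * r n) \<le> \<phi> powr (\<delta> / 2 * r n)) F"
    using w
  proof eventually_elim
    case (elim n)
    have "w n * \<phi> powr (\<delta> * r n) = exp (ln (w n) + \<delta> * r n * ln \<phi>)"
      using elim assms(1) by (simp add: powr_def exp_add)
    also have "\<dots> \<le> exp (\<delta> / 2 * r n * ln \<phi>)"
      using elim by (simp add: e_def algebra_simps abs_le_iff)
    finally show ?case using assms(1) by (simp add: powr_def)
  qed
qed

text \<open>Half of the exponent is spent on smallness in \<open>K\<close>; the other half stays
  available for summing over \<open>l\<close>.\<close>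

lemma powr_lnorm_tail_le:
  fixes q :: real
  assumes "0 < q" "q < 1" "K < lnorm l"
  shows "q powr lnorm l \<le> q powr (K / 2) * (q powr (1/2)) powr lnorm l"
proof -
  have "q powr lnorm l \<le> q powr (K / 2 + lnorm l / 2)"
    using assms by (intro powr_mono') auto
  then show ?thesis by (simp add: powr_add powr_powr)
qed

lemma sum_powr_lnorm_tail_le:
  fixes q :: real
  assumes "0 < q" "q < 1" "finite A" "\<And>l. l \<in> A \<Longrightarrow> K < lnorm l"
  shows "(\<Sum>l\<in>A. q powr lnorm l) \<le> q powr (K / 2) * geo_sum (q powr (1/2))"
proof -
  have q: "0 < q powr (1/2)" "q powr (1/2) < 1" using assms by (auto simp: powr01_less_one)
  have "(\<Sum>l\<in>A. q powr lnorm l) \<le> (\<Sum>l\<in>A. q powr (K / 2) * (q powr (1/2)) powr lnorm l)"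
    using assms by (intro sum_mono powr_lnorm_tail_le) auto
  also have "\<dots> \<le> q powr (K / 2) * geo_sum (q powr (1/2))"
    using assms(3) by (intro finite_sum_le_has_sum[OF has_sum_cmult_right[OF has_sum_powr_lnorm[OF q]]]) auto
  finally show ?thesis .
qed

section \<open>Growth of the thresholds and the four conditions\<close>

context frechet_field
begin

text \<open>A threshold below \<open>m n / 4\<close> would be exceeded with probability at least
  \<open>1 - exp (- 4 / m n) \<ge> 2 / m n\<close>, by the lag-0 noise alone, against the
  asymptotics \<open>1 / m n\<close>.\<close>

lemma eventually_threshold_ge:
  assumes m: "filterlim m at_top F"
    and a: "asymp_equiv (\<lambda>n. prob {\<omega> \<in> space M. a n < \<bar>max_moving \<phi> Z s \<omega>\<bar>}) F (\<lambda>n. 1 / m n)"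
  shows "eventually (\<lambda>n. m n / 4 \<le> a n) F"
proof -
  define p where "p n = prob {\<omega> \<in> space M. a n < \<bar>max_moving \<phi> Z s \<omega>\<bar>}" for n
  have "eventually (\<lambda>n. (if p n = 0 \<and> 1 / m n = 0 then 1 else p n / (1 / m n)) < 2) F"
    using a unfolding asymp_equiv_def p_def by (rule order_tendstoD(2)) simp
  moreover have "eventually (\<lambda>n. 4 \<le> m n) F" using m by (simp add: filterlim_at_top)
  ultimately show ?thesis
  proof eventually_elim
    case (elim n)
    then have lt: "p n < 2 / m n" by (simp add: field_simps)
    show ?case
    proof (rule ccontr)
      assume "\<not> m n / 4 \<le> a n"
      define u where "u = 4 / m n"
      have u: "0 < u" "u \<le> 1" using elim by (auto simp: u_def)
      \<comment> \<open>With \<open>exp (- u) \<le> 1 / (1 + u)\<close> this identity yields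
        \<open>u / 2 \<le> 1 - exp (- u)\<close> on the unit interval; \<open>u / 2\<close> is
        exactly \<open>2 / m n\<close>.\<close>
      have "1 - u / 2 - 1 / (1 + u) = u * (1 - u) / (2 * (1 + u))" using u by (simp add: field_simps)
      moreover have "0 \<le> u * (1 - u) / (2 * (1 + u))" using u by simp
      moreover have "exp (- u) \<le> 1 / (1 + u)"
        using exp_ge_add_one_self[of u] u by (simp add: exp_minus field_simps)
      ultimately have "u / 2 \<le> 1 - exp (- u)" by linarith
      also have "\<dots> = prob {\<omega> \<in> space M. m n / 4 < Z s \<omega>}"
        using prob_Z_gt[of "m n / 4" s] elim by (simp add: u_def)
      also have "\<dots> \<le> prob {\<omega> \<in> space M. a n < Z s \<omega>}"
        using \<open>\<not> m n / 4 \<le> a n\<close> by (intro finite_measure_mono) auto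
      also have "\<dots> \<le> p n" unfolding p_def by (rule prob_abs_max_moving_gt_ge)
      finally show False using lt by (simp add: u_def)
    qed
  qed
qed

text \<open>The two-shock term does not depend on the lag and is multiplied by the number of lags,
  at most \<open>9 * R\<^sup>2\<close>. The common-shock term is geometric in the lag, so its sum
  beyond \<open>K\<close> is a small tail.\<close>

lemma sum_prob_exceed_pair_le:
  assumes x: "0 < x" "Max ({}::real set) \<le> x" and R: "1 \<le> R"
  shows "(\<Sum>l | K < lnorm l \<and> lnorm l \<le> R.
      prob {\<omega> \<in> space M. exceed (max_moving \<phi> Z) (lball \<gamma>) x \<omega> \<and>
                         exceed (max_moving \<phi> Z) ((\<lambda>s. s + l) ` lball \<gamma>) x \<omega>})
    \<le> 9 * (real (card (lball \<gamma>)))\<^sup>2 * (geo_sum \<phi>)\<^sup>2 * R\<^sup>2 / x\<^sup>2 +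
       (real (card (lball \<gamma>)))\<^sup>2 * \<phi> powr (- \<gamma> / 2) * geo_sum (\<phi> powr (1/4)) * geo_sum (\<phi> powr (1/8))
         * \<phi> powr (K / 8) / x"
    (is "(\<Sum>l\<in>?A. ?p l) \<le> _")
proof -
  let ?c2 = "(real (card (lball \<gamma>)))\<^sup>2"
  define H where "H = \<phi> powr (- \<gamma> / 2) * geo_sum (\<phi> powr (1/4)) / x"
  have A: "?A \<subseteq> lball R" by (auto simp: lball_def)
  then have fin: "finite ?A" by (rule finite_subset) simp
  have "real (card ?A) \<le> real (card (lball R))" using card_mono[OF finite_lball A] by simp
  also have "\<dots> \<le> 9 * R\<^sup>2" by (rule card_lball_le[OF R])
  finally have cardA: "real (card ?A) \<le> 9 * R\<^sup>2" .
  have q: "0 < \<phi> powr (1/4)" "\<phi> powr (1/4) < 1"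
    using phi_pos phi_less_1 by (auto simp: powr01_less_one)
  have tail: "(\<Sum>l\<in>?A. (\<phi> powr (1/4)) powr lnorm l) \<le> \<phi> powr (K / 8) * geo_sum (\<phi> powr (1/8))"
    using sum_powr_lnorm_tail_le[OF q fin, of K] by (simp add: powr_powr)
  have "(\<Sum>l\<in>?A. ?p l) \<le> (\<Sum>l\<in>?A. ?c2 * ((geo_sum \<phi> / x)\<^sup>2 + H * (\<phi> powr (1/4)) powr lnorm l))"
  proof (rule sum_mono)
    fix l
    have "\<phi> powr ((lnorm l - 2 * \<gamma>) / 4) = \<phi> powr (- \<gamma> / 2) * (\<phi> powr (1/4)) powr lnorm l"
      by (simp add: powr_powr diff_divide_distrib flip: powr_add)
    then show "?p l \<le> ?c2 * ((geo_sum \<phi> / x)\<^sup>2 + H * (\<phi> powr (1/4)) powr lnorm l)"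
      using prob_exceed_pair_le[OF x, of \<gamma> l] by (simp add: H_def ac_simps)
  qed
  also have "\<dots> = ?c2 * (real (card ?A) * (geo_sum \<phi> / x)\<^sup>2 + H * (\<Sum>l\<in>?A. (\<phi> powr (1/4)) powr lnorm l))"
    by (simp add: sum.distrib flip: sum_distrib_left)
  also have "\<dots> \<le> ?c2 * (9 * R\<^sup>2 * (geo_sum \<phi> / x)\<^sup>2 + H * (\<phi> powr (K / 8) * geo_sum (\<phi> powr (1/8))))"
    using x geo_sum_nonneg
    by (intro mult_left_mono add_mono mult_right_mono cardA tail) (auto simp: H_def)
  finally show ?thesis by (simp add: H_def power_divide algebra_simps)
qed

text \<open>After multiplication by \<open>m n\<close>, the two-shock part is of order
  \<open>(r n)\<^sup>2 / m n\<close> and vanishes with \<open>n\<close>; the common-shock part is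
  free of \<open>n\<close> and vanishes with \<open>K\<close>.\<close>

lemma limsup_exceed_pair_tendsto_0:
  assumes m: "filterlim m at_top sequentially" and r: "filterlim r at_top sequentially"
    and rm: "(\<lambda>n. (r n)\<^sup>2) \<in> o(m)"
    and a: "eventually (\<lambda>n. m n / 4 \<le> a n) sequentially" and eps: "0 < \<epsilon>"
  shows "((\<lambda>K. limsup (\<lambda>n. ereal (m n *
         (\<Sum>l | K < lnorm l \<and> lnorm l \<le> r n.
            prob {\<omega> \<in> space M. exceed (max_moving \<phi> Z) (lball \<gamma>) (\<epsilon> * a n) \<omega> \<and>
                   exceed (max_moving \<phi> Z) ((\<lambda>s. s + l) ` lball \<gamma>) (\<epsilon> * a n) \<omega>}))))
         \<longlongrightarrow> 0) (at_top :: real filter)"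
    (is "((\<lambda>K. limsup (\<lambda>n. ereal (m n * ?S K n))) \<longlongrightarrow> 0) _")
proof -
  define A where "A = 9 * (real (card (lball \<gamma>)))\<^sup>2 * (geo_sum \<phi>)\<^sup>2"
  define B where "B = (real (card (lball \<gamma>)))\<^sup>2 * \<phi> powr (- \<gamma> / 2) * geo_sum (\<phi> powr (1/4))
    * geo_sum (\<phi> powr (1/8))"
  have nonneg: "0 \<le> A" "0 \<le> B" by (simp_all add: A_def B_def geo_sum_nonneg)
  have upper: "eventually (\<lambda>n. m n * ?S K n \<le> 16 * A / \<epsilon>\<^sup>2 * ((r n)\<^sup>2 / m n) + 4 * B / \<epsilon> * \<phi> powr (K / 8))
      sequentially" for K
  proof -
    \<comment> \<open>Ensures both that \<open>m n\<close> is positive and that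
      \<open>\<epsilon> * a n\<close>, being at least \<open>\<epsilon> * m n / 4\<close>, passes
      the default value \<open>Max {}\<close>.\<close>
    have "eventually (\<lambda>n. 4 * \<bar>Max ({}::real set)\<bar> / \<epsilon> + 1 \<le> m n) sequentially"
      "eventually (\<lambda>n. 1 \<le> r n) sequentially"
      using m r by (simp_all add: filterlim_at_top)
    then show ?thesis using a
    proof eventually_elim
      case (elim n)
      let ?x = "\<epsilon> * a n"
      have "0 \<le> 4 * \<bar>Max ({}::real set)\<bar> / \<epsilon>" using eps by simp
      then have mpos: "0 < m n" using elim by linarith
      have x_ge: "\<epsilon> * m n / 4 \<le> ?x" using mult_left_mono[OF elim(3), of \<epsilon>] eps by simp
      have xpos: "0 < ?x" using eps mpos elim(3) by (intro mult_pos_pos) auto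
      have "4 * \<bar>Max ({}::real set)\<bar> / \<epsilon> \<le> m n" using elim(1) by simp
      then have "4 * \<bar>Max ({}::real set)\<bar> \<le> \<epsilon> * m n" using eps by (simp add: field_simps)
      then have max: "Max ({}::real set) \<le> ?x" using x_ge by linarith
      have inv: "1 / ?x \<le> 4 / (\<epsilon> * m n)"
        using x_ge xpos mpos eps by (simp add: field_simps)
      have "?S K n \<le> A * (r n)\<^sup>2 / ?x\<^sup>2 + B * \<phi> powr (K / 8) / ?x"
        using sum_prob_exceed_pair_le[OF xpos max elim(2), of \<gamma> K] by (simp add: A_def B_def)
      also have "\<dots> = A * (r n)\<^sup>2 * (1 / ?x)\<^sup>2 + B * \<phi> powr (K / 8) * (1 / ?x)"
        by (simp add: power_divide)
      also have "\<dots> \<le> A * (r n)\<^sup>2 * (4 / (\<epsilon> * m n))\<^sup>2 + B * \<phi> powr (K / 8) * (4 / (\<epsilon> * m n))"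
        using nonneg xpos by (intro add_mono mult_left_mono power_mono inv) auto
      finally have "m n * ?S K n \<le> m n * (A * (r n)\<^sup>2 * (4 / (\<epsilon> * m n))\<^sup>2 + B * \<phi> powr (K / 8) * (4 / (\<epsilon> * m n)))"
        using mpos by (intro mult_left_mono) auto
      also have "\<dots> = 16 * A / \<epsilon>\<^sup>2 * ((r n)\<^sup>2 / m n) + 4 * B / \<epsilon> * \<phi> powr (K / 8)"
        using mpos eps by (simp add: field_simps power2_eq_square)
      finally show ?case .
    qed
  qed
  have lower: "eventually (\<lambda>n. 0 \<le> m n * ?S K n) sequentially" for K
  proof -
    have "eventually (\<lambda>n. 0 \<le> m n) sequentially" using m by (simp add: filterlim_at_top)
    then show ?thesis by eventually_elim (intro mult_nonneg_nonneg sum_nonneg measure_nonneg)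
  qed
  have ratio: "(\<lambda>n. (r n)\<^sup>2 / m n) \<longlonglongrightarrow> 0" using rm by (rule smalloD_tendsto)
  have limsup_le: "limsup (\<lambda>n. ereal (m n * ?S K n)) \<le> ereal (4 * B / \<epsilon> * \<phi> powr (K / 8))" for K
  proof -
    have "(\<lambda>n. 16 * A / \<epsilon>\<^sup>2 * ((r n)\<^sup>2 / m n) + 4 * B / \<epsilon> * \<phi> powr (K / 8))
        \<longlonglongrightarrow> 16 * A / \<epsilon>\<^sup>2 * 0 + 4 * B / \<epsilon> * \<phi> powr (K / 8)"
      by (intro tendsto_intros ratio)
    then have lim: "limsup (\<lambda>n. ereal (16 * A / \<epsilon>\<^sup>2 * ((r n)\<^sup>2 / m n) + 4 * B / \<epsilon> * \<phi> powr (K / 8)))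
        = ereal (4 * B / \<epsilon> * \<phi> powr (K / 8))"
      by (intro lim_imp_Limsup) (simp_all del: times_divide_eq_left times_divide_eq_right)
    have "limsup (\<lambda>n. ereal (m n * ?S K n))
        \<le> limsup (\<lambda>n. ereal (16 * A / \<epsilon>\<^sup>2 * ((r n)\<^sup>2 / m n) + 4 * B / \<epsilon> * \<phi> powr (K / 8)))"
      using upper[of K] by (intro Limsup_mono) (simp only: ereal_less_eq)
    with lim show ?thesis by simp
  qed
  have limsup_ge: "0 \<le> limsup (\<lambda>n. ereal (m n * ?S K n))" for K
    using lower[of K] by (intro le_Limsup) simp_all
  have "((\<lambda>K. 4 * B / \<epsilon> * \<phi> powr (1/8 * K)) \<longlongrightarrow> 4 * B / \<epsilon> * 0) at_top"
    using phi_pos phi_less_1 by (intro tendsto_mult tendsto_const powr_linear_tendsto_0 filterlim_ident) auto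
  then have "((\<lambda>K. ereal (4 * B / \<epsilon> * \<phi> powr (K / 8))) \<longlongrightarrow> 0) at_top"
    by (simp add: zero_ereal_def)
  with tendsto_const show ?thesis
    by (rule tendsto_sandwich[rotated 2]) (intro always_eventually allI limsup_ge limsup_le)+
qed

lemma mixing_coeff_summable:
  "(\<lambda>l. mixing_coeff M (max_moving \<phi> Z) j k (lnorm l)) summable_on UNIV"
proof -
  let ?D = "6 * geo_sum (\<phi> powr (1/4)) * real (j + k)"
  have "(\<lambda>l. ?D * (\<phi> powr (1/8)) powr lnorm l) summable_on UNIV"
    using phi_pos phi_less_1
    by (intro summable_on_cmult_right summable_on_powr_lnorm) (auto simp: powr01_less_one)
  \<comment> \<open>The exponential bound is available at positive distance only; the single lag 0
    is put back at the end.\<close>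
  then have "(\<lambda>l. ?D * (\<phi> powr (1/8)) powr lnorm l) summable_on (UNIV - {0})"
    by (rule summable_on_cofin_subset) simp
  then have "(\<lambda>l. mixing_coeff M (max_moving \<phi> Z) j k (lnorm l)) summable_on (UNIV - {0})"
  proof (rule summable_on_comparison_test)
    fix l :: "int \<times> int" assume "l \<in> UNIV - {0}"
    then have "0 < lnorm l" using lnorm_nonneg[of l] lnorm_eq_0_iff[of l] by (simp add: less_le)
    then show "mixing_coeff M (max_moving \<phi> Z) j k (lnorm l) \<le> ?D * (\<phi> powr (1/8)) powr lnorm l"
      and "0 \<le> mixing_coeff M (max_moving \<phi> Z) j k (lnorm l)"
      using mixing_coeff_nonneg mixing_coeff_le[of "lnorm l" j k] by (simp_all add: powr_powr)
  qed
  then have "(\<lambda>l. mixing_coeff M (max_moving \<phi> Z) j k (lnorm l)) summable_on insert 0 (UNIV - {0})"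
    by (simp only: summable_on_insert_iff)
  then show ?thesis by simp
qed

text \<open>Splitting the decay rate 1/8 in half leaves 1/16 for the cutoff \<open>R\<close> and
  1/16 for the sum over lags.\<close>

lemma infsum_mixing_coeff_tail_le:
  assumes "0 \<le> R"
  shows "(\<Sum>\<^sub>\<infinity>l\<in>{l. R < lnorm l}. mixing_coeff M (max_moving \<phi> Z) j k (lnorm l))
    \<le> 6 * geo_sum (\<phi> powr (1/4)) * real (j + k) * geo_sum (\<phi> powr (1/16)) * \<phi> powr (R / 16)"
proof -
  let ?D = "6 * geo_sum (\<phi> powr (1/4)) * real (j + k)"
  let ?g = "\<lambda>l. ?D * \<phi> powr (R / 16) * (\<phi> powr (1/16)) powr lnorm l"
  have q: "0 < \<phi> powr (1/8)" "\<phi> powr (1/8) < 1" "0 < \<phi> powr (1/16)" "\<phi> powr (1/16) < 1"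
    using phi_pos phi_less_1 by (auto simp: powr01_less_one)
  have g: "(?g has_sum ?D * \<phi> powr (R / 16) * geo_sum (\<phi> powr (1/16))) UNIV"
    by (intro has_sum_cmult_right has_sum_powr_lnorm q)
  have "(\<Sum>\<^sub>\<infinity>l\<in>{l. R < lnorm l}. mixing_coeff M (max_moving \<phi> Z) j k (lnorm l)) \<le> infsum ?g UNIV"
  proof (rule infsum_mono_neutral)
    show "(\<lambda>l. mixing_coeff M (max_moving \<phi> Z) j k (lnorm l)) summable_on {l. R < lnorm l}"
      using mixing_coeff_summable by (rule summable_on_subset_banach) simp
    show "?g summable_on UNIV" using g by (rule has_sum_imp_summable)
    fix l
    show "mixing_coeff M (max_moving \<phi> Z) j k (lnorm l) \<le> ?g l"
      if "l \<in> {l. R < lnorm l} \<inter> UNIV"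
    proof -
      have l: "R < lnorm l" using that by simp
      then have "mixing_coeff M (max_moving \<phi> Z) j k (lnorm l) \<le> ?D * (\<phi> powr (1/8)) powr lnorm l"
        using mixing_coeff_le[of "lnorm l" j k] assms by (simp add: powr_powr)
      also have "\<dots> \<le> ?D * ((\<phi> powr (1/8)) powr (R / 2) * ((\<phi> powr (1/8)) powr (1/2)) powr lnorm l)"
        by (intro mult_left_mono powr_lnorm_tail_le q l) (simp add: geo_sum_nonneg)
      finally show ?thesis by (simp add: powr_powr)
    qed
    show "0 \<le> ?g l" by (simp add: geo_sum_nonneg)
  qed simp
  also have "infsum ?g UNIV = ?D * \<phi> powr (R / 16) * geo_sum (\<phi> powr (1/16))"
    using g by (rule infsumI)
  finally show ?thesis by (simp add: ac_simps)
qed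

lemma mixing_coeff_tail_tendsto_0:
  assumes m: "filterlim m at_top sequentially" and r: "filterlim r at_top sequentially"
    and "(\<lambda>n. ln (m n)) \<in> o(r)"
  shows "(\<lambda>n. m n * (\<Sum>\<^sub>\<infinity>l\<in>{l. r n < lnorm l}. mixing_coeff M (max_moving \<phi> Z) j k (lnorm l))) \<longlonglongrightarrow> 0"
proof (rule tendsto_sandwich)
  let ?D = "6 * geo_sum (\<phi> powr (1/4)) * real (j + k) * geo_sum (\<phi> powr (1/16))"
  have ev: "eventually (\<lambda>n. 0 < m n) sequentially" "eventually (\<lambda>n. 0 \<le> r n) sequentially"
    using m r by (simp add: filterlim_at_top_dense, simp add: filterlim_at_top)
  show "eventually (\<lambda>n. 0 \<le> m n * (\<Sum>\<^sub>\<infinity>l\<in>{l. r n < lnorm l}. mixing_coeff M (max_moving \<phi> Z) j k (lnorm l)))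
      sequentially"
    using ev by eventually_elim (intro mult_nonneg_nonneg infsum_nonneg mixing_coeff_nonneg; simp)
  show "eventually (\<lambda>n. m n * (\<Sum>\<^sub>\<infinity>l\<in>{l. r n < lnorm l}. mixing_coeff M (max_moving \<phi> Z) j k (lnorm l))
      \<le> ?D * (m n * \<phi> powr (1/16 * r n))) sequentially"
    using ev
  proof eventually_elim
    case (elim n)
    then show ?case
      using mult_left_mono[OF infsum_mixing_coeff_tail_le[of "r n" j k], of "m n"] by (simp add: ac_simps)
  qed
  have "(\<lambda>n. ?D * (m n * \<phi> powr (1/16 * r n))) \<longlonglongrightarrow> ?D * 0"
    using phi_pos phi_less_1 assms ev by (intro tendsto_mult tendsto_const mult_powr_tendsto_0) auto
  then show "(\<lambda>n. ?D * (m n * \<phi> powr (1/16 * r n))) \<longlonglongrightarrow> 0" by simp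
qed simp

text \<open>The whole expression is at most a constant times
  \<open>n ^ 3 * m n * \<phi> powr (m n / 8)\<close>. Three factors with rate 1/48 each absorb one
  \<open>n\<close>, and the remaining rate 1/16 absorbs \<open>m n\<close>.\<close>

lemma mixing_coeff_quadratic_tendsto_0:
  assumes m: "filterlim m at_top sequentially" and ln_n: "(\<lambda>n. ln (real n)) \<in> o(m)"
  shows "(\<lambda>n. real n * m n powr (1/2) * mixing_coeff M (max_moving \<phi> Z) c (c * n\<^sup>2) (m n)) \<longlonglongrightarrow> 0"
proof (rule tendsto_sandwich)
  let ?D = "12 * geo_sum (\<phi> powr (1/4)) * real c"
  let ?u = "\<lambda>n. ?D * ((real n * \<phi> powr (1/48 * m n)) ^ 3 * (m n * \<phi> powr (1/16 * m n)))"
  have ev: "eventually (\<lambda>n. 1 \<le> m n) sequentially" "eventually (\<lambda>n. 1 \<le> n) sequentially"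
    using m by (simp_all add: filterlim_at_top eventually_ge_at_top)
  show "eventually (\<lambda>n. 0 \<le> real n * m n powr (1/2) * mixing_coeff M (max_moving \<phi> Z) c (c * n\<^sup>2) (m n))
      sequentially"
    using ev by eventually_elim (intro mult_nonneg_nonneg mixing_coeff_nonneg; simp)
  show "eventually (\<lambda>n. real n * m n powr (1/2) * mixing_coeff M (max_moving \<phi> Z) c (c * n\<^sup>2) (m n)
      \<le> ?u n) sequentially"
    using ev
  proof eventually_elim
    case (elim n)
    have "m n powr (1/2) \<le> m n powr 1" using elim by (intro powr_mono) auto
    then have sqrt: "m n powr (1/2) \<le> m n" using elim by simp
    have "1 * real c \<le> (real n)\<^sup>2 * real c"
      using elim by (intro mult_right_mono) (auto intro!: one_le_power)
    then have "real (c + c * n\<^sup>2) \<le> 2 * real c * (real n)\<^sup>2" by (simp add: algebra_simps)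
    then have "6 * geo_sum (\<phi> powr (1/4)) * real (c + c * n\<^sup>2) * \<phi> powr (m n / 8)
        \<le> 6 * geo_sum (\<phi> powr (1/4)) * (2 * real c * (real n)\<^sup>2) * \<phi> powr (m n / 8)"
      using geo_sum_nonneg by (intro mult_right_mono mult_left_mono) auto
    then have "mixing_coeff M (max_moving \<phi> Z) c (c * n\<^sup>2) (m n) \<le> ?D * (real n)\<^sup>2 * \<phi> powr (m n / 8)"
      using mixing_coeff_le[of "m n" c "c * n\<^sup>2"] elim by linarith
    then have "real n * m n powr (1/2) * mixing_coeff M (max_moving \<phi> Z) c (c * n\<^sup>2) (m n)
        \<le> real n * m n * (?D * (real n)\<^sup>2 * \<phi> powr (m n / 8))"
      using sqrt elim mixing_coeff_nonneg by (intro mult_mono) auto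
    also have "\<dots> = ?D * (real n ^ 3 * m n * \<phi> powr (m n / 8))"
      by (simp add: power2_eq_square power3_eq_cube)
    also have "\<phi> powr (m n / 8) = (\<phi> powr (1/48 * m n)) ^ 3 * \<phi> powr (1/16 * m n)"
      by (simp add: power3_eq_cube flip: powr_add)
    finally show ?case by (simp add: power_mult_distrib ac_simps)
  qed
  have "((\<lambda>x. ln x) \<in> o(\<lambda>x::real. x))"
    by (rule smalloI_tendsto[OF ln_x_over_x_tendsto_0]) (rule eventually_mono[OF eventually_gt_at_top[of 0]], simp)
  then have "(\<lambda>n. ln (m n)) \<in> o(m)" by (rule landau_o.small.compose[OF _ m])
  then have "(\<lambda>n. m n * \<phi> powr (1/16 * m n)) \<longlonglongrightarrow> 0"
    using phi_pos phi_less_1 m by (intro mult_powr_tendsto_0) (auto simp: filterlim_at_top_dense)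
  moreover have "(\<lambda>n. real n * \<phi> powr (1/48 * m n)) \<longlonglongrightarrow> 0"
    using phi_pos phi_less_1 m ln_n by (intro mult_powr_tendsto_0) (auto intro: eventually_gt_at_top)
  ultimately have "?u \<longlonglongrightarrow> ?D * (0 ^ 3 * 0)"
    by (intro tendsto_mult tendsto_const tendsto_power)
  then show "?u \<longlonglongrightarrow> 0" by simp
qed simp

end

text \<open>An infinite sum defaults to 0 on a non-summable family, so the second condition asserts
  summability next to the limit.\<close>

theorem mainTheorem3:
  fixes M :: "'a measure"
    and Z X :: "int \<times> int \<Rightarrow> 'a \<Rightarrow> real"
    and \<phi> \<gamma> :: real
    and m r a :: "nat \<Rightarrow> real"
    and c :: nat
  assumes "prob_space M"
    and "0 < \<phi>" and "\<phi> < 1"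
    and "prob_space.indep_vars M (\<lambda>_. borel) Z UNIV"
    and "\<And>s. unit_frechet M (Z s)"
    and "X = max_moving \<phi> Z"
    and "filterlim m at_top sequentially"
    and "filterlim r at_top sequentially"
    and "(\<lambda>n. (r n)\<^sup>2) \<in> o(m)"
    and "(\<lambda>n. ln (m n)) \<in> o(r)"
    and "(\<lambda>n. ln (real n)) \<in> o(m)"
    and "asymp_equiv (\<lambda>n. measure M {\<omega> \<in> space M. \<bar>X 0 \<omega>\<bar> > a n}) sequentially (\<lambda>n. 1 / m n)"
    and "c = card (lball \<gamma>)"
  shows
    "(\<forall>\<epsilon>>0. ((\<lambda>K. limsup (\<lambda>n. ereal (m n *
         (\<Sum>l | K < lnorm l \<and> lnorm l \<le> r n.
            measure M {\<omega> \<in> space M. exceed X (lball \<gamma>) (\<epsilon> * a n) \<omega> \<and>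
                                    exceed X ((\<lambda>s. s + l) ` lball \<gamma>) (\<epsilon> * a n) \<omega>}))))
         \<longlongrightarrow> 0) (at_top :: real filter))
     \<and> ((\<forall>n. (\<lambda>l. mixing_coeff M X c c (lnorm l)) summable_on {l. r n < lnorm l}) \<and>
        (\<lambda>n. m n * (\<Sum>\<^sub>\<infinity>l\<in>{l. r n < lnorm l}. mixing_coeff M X c c (lnorm l))) \<longlonglongrightarrow> 0)
     \<and> (\<forall>j1 j2. 2 * c \<le> j1 + j2 \<and> j1 + j2 \<le> 4 * c \<longrightarrow>
          (\<lambda>l. mixing_coeff M X j1 j2 (lnorm l)) summable_on UNIV)
     \<and> (\<lambda>n. real n * m n powr (1/2) * mixing_coeff M X c (c * n\<^sup>2) (m n)) \<longlonglongrightarrow> 0"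
proof -
  interpret frechet_field M Z \<phi>
    using assms(1-5) by (simp add: frechet_field_def frechet_field_axioms_def)
  note X = assms(6)
  have a: "eventually (\<lambda>n. m n / 4 \<le> a n) sequentially"
    using eventually_threshold_ge[OF assms(7), of a 0] assms(12) by (simp add: X)
  show ?thesis
    unfolding X
    using assms(7-11) a mixing_coeff_summable
    by (intro conjI allI impI limsup_exceed_pair_tendsto_0 mixing_coeff_tail_tendsto_0
        mixing_coeff_quadratic_tendsto_0 summable_on_subset_banach[OF mixing_coeff_summable]) auto
qed

end
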